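(* Let $D$ be a real composition division algebra of dimension $d\in\{2,4,8\}$, let $E_D\to\mathbb{RP}^d$ be its coordinate-deletion bundle and $\tau$ the trivialization of $E_D$ over $X=\mathbb{RP}^d\setminus\{P_0,\dots,P_d\}$ given on $U_i\cap X$ by $w_i\mapsto M_i^{-1}w_i$ (all defined in the context). Choose pairwise disjoint closed coordinate balls $B_i\subset U_i$ centered at $P_i$, small enough that the affine-coordinate map $p\mapsto q_i(p)$ identifies $B_i$ with a closed ball in $D$ centered at $0$. Use the original $U_i$-frame on $B_i$ and the trivialization $\tau$ outside the centers. Then on $\partial B_i\cong S^{d-1}$ the clutching map between the local $U_i$-frame and the punctured-space trivialization $\tau$ is represented by $M_i=L_{q_i}$ (i.e. if $w$ denotes coordinates with respect to $\tau$ and $w_i$ coordinates in the $U_i$-frame, then $w_i=M_iw$). After radial normalization it is homotopic through $\mathrm{GL}_d^+(\mathbb R)$ to $$\lambda_D:S^{d-1}\longrightarrow\mathrm{SO}(d),\qquad u\longmapsto L_u,$$ where $N(u)=1$. For $D=\mathbb C$ and $D=\mathbb H$, $\lambda_D$ is the underlying real clutching map of the complex, respectively quaternionic, Hopf line bundle. For $D=\mathbb O$, it is the standard octonionic Hopf clutching map associated with the fibration $S^7\to S^{15}\to S^8$ (as a clutching map of a real rank-eight vector bundle over $S^8$; $S^7$ is not claimed to be a structure group).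
   Context: $D$ is a finite-dimensional unital (not necessarily associative) real composition division algebra with multiplicative quadratic norm $N:D\to\mathbb R$, $N(uv)=N(u)N(v)$, $N(1)=1$, whose polar form $\langle u,v\rangle=\frac12(N(u+v)-N(u)-N(v))$ is positive definite, and $d=\dim_{\mathbb R}D\in\{2,4,8\}$; thus $D\cong\mathbb C,\mathbb H$ or $\mathbb O$. Fix an ordered orthonormal basis $(e_0,\dots,e_{d-1})$ of $D$, identifying $D$ with $\mathbb R^d$ and the norm-one elements of $D$ with $S^{d-1}$. For $u\in D$, $L_u(v)=uv$ and $M(u)\in M_d(\mathbb R)$ is the matrix of $L_u$ in this basis. On $\mathbb{RP}^d=\{[\alpha_0:\cdots:\alpha_d]\}$ let $U_i=\{\alpha_i\neq0\}$, let $P_i=[0:\cdots:0:1:0:\cdots:0]$ ($1$ in position $i$, $i=0,\dots,d$) be the coordinate points, let $\sigma_i:\{0,\dots,d-1\}\to\{0,\dots,d\}\setminus\{i\}$ be the increasing bijection, define $q_i:U_i\to D$ by $q_i([\alpha])=\sum_{r=0}^{d-1}\frac{\alpha_{\sigma_i(r)}}{\alpha_i}e_r$, and put $M_i(p)=M(q_i(p))$; $M_i(p)$ is invertible for $p\in U_i\setminus\{P_i\}$. The bundle $E_D\to\mathbb{RP}^d$ is the rank-$d$ real vector bundle obtained by gluing the $U_i\times\mathbb R^d$ via the transition functions $g_{ij}=M_iM_j^{-1}:U_i\cap U_j\to\mathrm{GL}_d(\mathbb R)$ for $i\ne j$ (and $g_{ii}=I_d$), with the convention that local representatives of a vector satisfy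 $w_i=g_{ij}w_j$. The formulas $w_i\mapsto M_i^{-1}w_i$ agree on overlaps and define the trivialization $\tau:E_D|_X\cong X\times\mathbb R^d$. Conventions: a map $S^{d-1}\to\mathrm{SO}(d)$ is the clutching map of the rank-$d$ real vector bundle over $S^d$ obtained by gluing two trivial bundles over hemispheres along the equator. The Hopf line bundles are the tautological bundles over $\mathbb{CP}^1=S^2$ and $\mathbb{HP}^1=S^4$; the octonionic Hopf clutching map is the one whose rank-eight bundle over $S^8$ has unit sphere bundle the octonionic Hopf fibration. The local model is relative to the ordered coordinates, the ordered basis, the standard cover and $\tau$; reversing an orientation of $\partial B_i\cong S^{d-1}$ (equivalently of the base sphere) can replace the oriented homotopy class by its negative, and no absolute sign is claimed. *)

theory Defs
  imports "HOL-Analysis.Analysis"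
begin

section \<open>Real composition division algebras\<close>

definition polar :: "('a::real_vector \<Rightarrow> real) \<Rightarrow> 'a \<Rightarrow> 'a \<Rightarrow> real" where
  "polar N u v = (N (u + v) - N u - N v) / 2"

text \<open>Finite-dimensionality is not part of the predicate: it is supplied by a finite orthonormal
  basis. No associativity is assumed.\<close>

definition composition_division_algebra ::
    "('a::real_vector \<Rightarrow> 'a \<Rightarrow> 'a) \<Rightarrow> 'a \<Rightarrow> ('a \<Rightarrow> real) \<Rightarrow> bool" where
  "composition_division_algebra mul one N \<longleftrightarrow>
     bilinear mul \<and> (\<forall>u. mul one u = u \<and> mul u one = u) \<and>
     (\<forall>u. u \<noteq> 0 \<longrightarrow> bij (mul u) \<and> bij (\<lambda>v. mul v u)) \<and>
     (\<forall>c u. N (c *\<^sub>R u) = c\<^sup>2 * N u) \<and> bilinear (polar N) \<and>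
     (\<forall>u. u \<noteq> 0 \<longrightarrow> polar N u u > 0) \<and>
     (\<forall>u v. N (mul u v) = N u * N v) \<and> N one = 1"

definition orthonormal_basis :: "('a::real_vector \<Rightarrow> real) \<Rightarrow> ('n::finite \<Rightarrow> 'a) \<Rightarrow> bool" where
  "orthonormal_basis N e \<longleftrightarrow>
     (\<forall>r s. polar N (e r) (e s) = (if r = s then 1 else 0)) \<and> span (range e) = UNIV"

definition from_coords :: "('n::finite \<Rightarrow> 'a::real_vector) \<Rightarrow> real^'n \<Rightarrow> 'a" where
  "from_coords e x = (\<Sum>r\<in>UNIV. (x $ r) *\<^sub>R e r)"

definition to_coords :: "('n::finite \<Rightarrow> 'a::real_vector) \<Rightarrow> 'a \<Rightarrow> real^'n" where
  "to_coords e = inv (from_coords e)"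

definition left_mult_matrix ::
    "('a::real_vector \<Rightarrow> 'a \<Rightarrow> 'a) \<Rightarrow> ('n::finite \<Rightarrow> 'a) \<Rightarrow> 'a \<Rightarrow> real^'n^'n" where
  "left_mult_matrix mul e u = matrix (\<lambda>x. to_coords e (mul u (from_coords e x)))"

text \<open>The map $\lambda_D$; the norm-one elements of the algebra are the points of the unit sphere of
  the coordinate space.\<close>

definition lambda_map ::
    "('a::real_vector \<Rightarrow> 'a \<Rightarrow> 'a) \<Rightarrow> ('n::finite \<Rightarrow> 'a) \<Rightarrow> real^'n \<Rightarrow> real^'n^'n" where
  "lambda_map mul e x = left_mult_matrix mul e (from_coords e x)"

section \<open>Quotient topologies and gluing of trivial bundles\<close>

definition quotient_topology :: "'a topology \<Rightarrow> ('a \<Rightarrow> 'b) \<Rightarrow> 'b topology" where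
  "quotient_topology X f =
     topology (\<lambda>W. W \<subseteq> f ` topspace X \<and> openin X {x \<in> topspace X. f x \<in> W})"

lemma openin_quotient_topology:
  "openin (quotient_topology X f) W \<longleftrightarrow>
     W \<subseteq> f ` topspace X \<and> openin X {x \<in> topspace X. f x \<in> W}"
proof -
  have "istopology (\<lambda>W. W \<subseteq> f ` topspace X \<and> openin X {x \<in> topspace X. f x \<in> W})"
    unfolding istopology_def
  proof (intro conjI allI impI)
    fix S T
    assume S: "S \<subseteq> f ` topspace X \<and> openin X {x \<in> topspace X. f x \<in> S}"
      and T: "T \<subseteq> f ` topspace X \<and> openin X {x \<in> topspace X. f x \<in> T}"
    then show "S \<inter> T \<subseteq> f ` topspace X" by blast
    have "{x \<in> topspace X. f x \<in> S \<inter> T} = {x \<in> topspace X. f x \<in> S} \<inter> {x \<in> topspace X. f x \<in> T}"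
      by blast
    with S T show "openin X {x \<in> topspace X. f x \<in> S \<inter> T}" by auto
  next
    fix K
    assume K: "\<forall>W\<in>K. W \<subseteq> f ` topspace X \<and> openin X {x \<in> topspace X. f x \<in> W}"
    then show "\<Union>K \<subseteq> f ` topspace X" by blast
    have "{x \<in> topspace X. f x \<in> \<Union>K} = (\<Union>W\<in>K. {x \<in> topspace X. f x \<in> W})" by blast
    with K show "openin X {x \<in> topspace X. f x \<in> \<Union>K}" by auto
  qed
  then show ?thesis by (simp add: quotient_topology_def)
qed

lemma topspace_quotient_topology: "topspace (quotient_topology X f) = f ` topspace X"
proof
  show "topspace (quotient_topology X f) \<subseteq> f ` topspace X"
    by (metis openin_quotient_topology openin_topspace)
  have "{x \<in> topspace X. f x \<in> f ` topspace X} = topspace X" by blast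
  then have "openin (quotient_topology X f) (f ` topspace X)"
    by (simp add: openin_quotient_topology)
  then show "f ` topspace X \<subseteq> topspace (quotient_topology X f)" by (rule openin_subset)
qed

lemma quotient_map_quotient_topology: "quotient_map X (quotient_topology X f) f"
  by (simp add: quotient_map_def topspace_quotient_topology openin_quotient_topology)

text \<open>A cover \<open>U\<close> of a base \<open>X\<close> and transition functions \<open>g\<close>; the points \<open>(j, p, w\<^sub>j)\<close> and
  \<open>(i, p, w\<^sub>i)\<close> are identified when \<open>w\<^sub>i = g i j p *v w\<^sub>j\<close>. Points of the glued space are equivalence
  classes of such triples.\<close>

definition glue_rel ::
    "('i \<Rightarrow> 'b set) \<Rightarrow> ('i \<Rightarrow> 'i \<Rightarrow> 'b \<Rightarrow> real^'n^'n) \<Rightarrow> (('i \<times> 'b \<times> (real^'n)) \<times> ('i \<times> 'b \<times> (real^'n))) set"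
  where
  "glue_rel U g =
     {((i, p, v), (j, p', w)). p = p' \<and> p \<in> U i \<inter> U j \<and> v = g i j p *v w}"

definition glue_point ::
    "('i \<Rightarrow> 'b set) \<Rightarrow> ('i \<Rightarrow> 'i \<Rightarrow> 'b \<Rightarrow> real^'n^'n) \<Rightarrow> 'i \<times> 'b \<times> (real^'n) \<Rightarrow> ('i \<times> 'b \<times> (real^'n)) set"
  where
  "glue_point U g z = glue_rel U g `` {z}"

definition glued_bundle ::
    "'b topology \<Rightarrow> ('i \<Rightarrow> 'b set) \<Rightarrow> ('i \<Rightarrow> 'i \<Rightarrow> 'b \<Rightarrow> real^'n^'n) \<Rightarrow> ('i \<times> 'b \<times> (real^'n)) set topology"
  where
  "glued_bundle X U g =
     quotient_topology
       (sum_topology (\<lambda>i. prod_topology (subtopology X (U i)) euclidean) UNIV) (glue_point U g)"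

definition glue_proj :: "('i \<times> 'b \<times> (real^'n)) set \<Rightarrow> 'b" where
  "glue_proj c = (THE p. \<exists>i w. (i, p, w) \<in> c)"

definition glue_coord :: "'i \<Rightarrow> ('i \<times> 'b \<times> (real^'n)) set \<Rightarrow> real^'n" where
  "glue_coord i c = (THE w. \<exists>p. (i, p, w) \<in> c)"

definition local_frame :: "'i \<Rightarrow> ('i \<times> 'b \<times> (real^'n)) set \<Rightarrow> 'b \<times> (real^'n)" where
  "local_frame i c = (glue_proj c, glue_coord i c)"

definition restricted_bundle ::
    "'b topology \<Rightarrow> ('i \<Rightarrow> 'b set) \<Rightarrow> ('i \<Rightarrow> 'i \<Rightarrow> 'b \<Rightarrow> real^'n^'n) \<Rightarrow> 'b set \<Rightarrow> ('i \<times> 'b \<times> (real^'n)) set topology"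
  where
  "restricted_bundle X U g A = subtopology (glued_bundle X U g) {c. glue_proj c \<in> A}"

definition is_trivialization ::
    "'b topology \<Rightarrow> ('i \<Rightarrow> 'b set) \<Rightarrow> ('i \<Rightarrow> 'i \<Rightarrow> 'b \<Rightarrow> real^'n^'n) \<Rightarrow> 'b set \<Rightarrow>
       (('i \<times> 'b \<times> (real^'n)) set \<Rightarrow> 'b \<times> (real^'n)) \<Rightarrow> bool" where
  "is_trivialization X U g A \<phi> \<longleftrightarrow>
     homeomorphic_map (restricted_bundle X U g A)
       (prod_topology (subtopology X A) euclidean) \<phi> \<and>
     (\<forall>c \<in> topspace (restricted_bundle X U g A). fst (\<phi> c) = glue_proj c) \<and>
     (\<forall>i. \<forall>p \<in> A \<inter> U i. linear (\<lambda>w. snd (\<phi> (glue_point U g (i, p, w)))))"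

text \<open>The matrix \<open>A\<close> at \<open>p\<close> with \<open>w' = A *v w\<close> whenever a vector over \<open>p\<close> has coordinates \<open>w\<close> with
  respect to \<open>\<psi>\<close> and \<open>w'\<close> with respect to \<open>\<phi>\<close>; here \<open>S\<close> is a set of vectors on which \<open>\<psi>\<close> is
  injective.\<close>

definition clutching_map ::
    "'c set \<Rightarrow> ('c \<Rightarrow> 'b \<times> (real^'n)) \<Rightarrow> ('c \<Rightarrow> 'b \<times> (real^'n)) \<Rightarrow> 'b \<Rightarrow> real^'n^'n" where
  "clutching_map S \<phi> \<psi> p = matrix (\<lambda>w. snd (\<phi> (inv_into S \<psi> (p, w))))"

section \<open>The coordinate-deletion bundle\<close>

text \<open>A point of the projective space is the line spanned by its homogeneous coordinates. The
  homogeneous coordinates are indexed by a finite chain \<open>'m\<close> with one element more than the chain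
  \<open>'n\<close> which indexes the basis, in place of $\{0,\dots,d\}$ and $\{0,\dots,d-1\}$.\<close>

definition real_proj_space :: "(real^'m) set topology" where
  "real_proj_space = quotient_topology (top_of_set (- {0})) (\<lambda>\<alpha>. span {\<alpha>})"

definition homog_coords :: "(real^'m) set \<Rightarrow> real^'m" where
  "homog_coords p = (SOME \<alpha>. \<alpha> \<noteq> 0 \<and> span {\<alpha>} = p)"

definition std_open :: "'m::finite \<Rightarrow> (real^'m) set set" where
  "std_open i = {p \<in> topspace real_proj_space. homog_coords p $ i \<noteq> 0}"

definition coord_point :: "'m::finite \<Rightarrow> (real^'m) set" where
  "coord_point i = span {axis i 1}"

definition skip_index :: "'m::{finite,linorder} \<Rightarrow> 'n::{finite,linorder} \<Rightarrow> 'm" where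
  "skip_index i = (THE \<sigma>. strict_mono \<sigma> \<and> range \<sigma> = UNIV - {i})"

definition affine_coord ::
    "('n::{finite,linorder} \<Rightarrow> 'a::real_vector) \<Rightarrow> 'm::{finite,linorder} \<Rightarrow> (real^'m::_) set \<Rightarrow> 'a" where
  "affine_coord e i p =
     (\<Sum>r\<in>UNIV. (homog_coords p $ skip_index i r / homog_coords p $ i) *\<^sub>R e r)"

definition chart_matrix ::
    "('a::real_vector \<Rightarrow> 'a \<Rightarrow> 'a) \<Rightarrow> ('n::{finite,linorder} \<Rightarrow> 'a) \<Rightarrow> 'm::{finite,linorder} \<Rightarrow>
       (real^'m::_) set \<Rightarrow> real^'n::_^'n::_" where
  "chart_matrix mul e i p = left_mult_matrix mul e (affine_coord e i p)"

definition deletion_transition ::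
    "('a::real_vector \<Rightarrow> 'a \<Rightarrow> 'a) \<Rightarrow> ('n::{finite,linorder} \<Rightarrow> 'a) \<Rightarrow> 'm::{finite,linorder} \<Rightarrow> 'm \<Rightarrow>
       (real^'m::_) set \<Rightarrow> real^'n::_^'n::_" where
  "deletion_transition mul e i j p =
     (if i = j then mat 1 else chart_matrix mul e i p ** matrix_inv (chart_matrix mul e j p))"

definition punctured_space :: "(real^'m) set set" where
  "punctured_space = topspace real_proj_space - range coord_point"

text \<open>The common value over all charts of the local formulas \<open>w\<^sub>i \<mapsto> M\<^sub>i\<inverse> w\<^sub>i\<close>.\<close>

definition tau ::
    "('a::real_vector \<Rightarrow> 'a \<Rightarrow> 'a) \<Rightarrow> ('n::{finite,linorder} \<Rightarrow> 'a) \<Rightarrow>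
       ('m::{finite,linorder} \<times> (real^'m::_) set \<times> (real^'n::_)) set \<Rightarrow> (real^'m::_) set \<times> (real^'n::_)" where
  "tau mul e c =
     (glue_proj c,
      THE w. \<forall>i. glue_proj c \<in> std_open i \<longrightarrow>
        w = matrix_inv (chart_matrix mul e i (glue_proj c)) *v glue_coord i c)"

section \<open>Clutching over a sphere\<close>

text \<open>The sphere $S^d$ is the unit sphere of \<open>real^'n \<times> real\<close>, with equator \<open>t = 0\<close>; the index
  \<open>True\<close> stands for the hemisphere \<open>t \<ge> 0\<close>. A clutching map \<open>cl\<close> identifies \<open>w\<close> in the lower trivial
  bundle with \<open>cl x *v w\<close> in the upper one.\<close>

definition hemisphere :: "bool \<Rightarrow> ((real^'n) \<times> real) set" where
  "hemisphere s = {p \<in> sphere 0 1. if s then snd p \<ge> 0 else snd p \<le> 0}"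

definition clutch_transition ::
    "(real^'n \<Rightarrow> real^'n^'n) \<Rightarrow> bool \<Rightarrow> bool \<Rightarrow> (real^'n) \<times> real \<Rightarrow> real^'n^'n" where
  "clutch_transition cl s s' p =
     (if s = s' then mat 1 else if s then cl (fst p) else matrix_inv (cl (fst p)))"

definition clutch_point ::
    "(real^'n \<Rightarrow> real^'n^'n) \<Rightarrow> bool \<times> ((real^'n) \<times> real) \<times> (real^'n) \<Rightarrow>
       (bool \<times> ((real^'n) \<times> real) \<times> (real^'n)) set" where
  "clutch_point cl = glue_point hemisphere (clutch_transition cl)"

definition clutched_bundle ::
    "(real^'n \<Rightarrow> real^'n^'n) \<Rightarrow> (bool \<times> ((real^'n) \<times> real) \<times> (real^'n)) set topology" where
  "clutched_bundle cl =
     glued_bundle (top_of_set (sphere 0 1)) hemisphere (clutch_transition cl)"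

section \<open>Quaternions, octonions and the Hopf bundles\<close>

text \<open>Cayley--Dickson doubling of the complex numbers. The Euclidean norm of the product types is
  the usual norm of quaternions and octonions.\<close>

type_synonym quat = "complex \<times> complex"
type_synonym oct = "quat \<times> quat"

fun quat_mult :: "quat \<Rightarrow> quat \<Rightarrow> quat" where
  "quat_mult (a, b) (c, d) = (a * c - cnj d * b, d * a + b * cnj c)"

fun quat_cnj :: "quat \<Rightarrow> quat" where
  "quat_cnj (a, b) = (cnj a, - b)"

fun oct_mult :: "oct \<Rightarrow> oct \<Rightarrow> oct" where
  "oct_mult (p, q) (r, s) =
     (quat_mult p r - quat_mult (quat_cnj s) q, quat_mult s p + quat_mult q (quat_cnj r))"

fun oct_cnj :: "oct \<Rightarrow> oct" where
  "oct_cnj (p, q) = (quat_cnj p, - q)"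

text \<open>Isomorphisms of composition algebras onto an algebra normed by its Euclidean norm.\<close>

definition composition_iso ::
    "('a::real_vector \<Rightarrow> 'a \<Rightarrow> 'a) \<Rightarrow> ('a \<Rightarrow> real) \<Rightarrow> ('k::euclidean_space \<Rightarrow> 'k \<Rightarrow> 'k) \<Rightarrow>
       ('a \<Rightarrow> 'k) \<Rightarrow> bool" where
  "composition_iso mul N mulK \<phi> \<longleftrightarrow>
     linear \<phi> \<and> bij \<phi> \<and> (\<forall>u v. \<phi> (mul u v) = mulK (\<phi> u) (\<phi> v)) \<and> (\<forall>u. (norm (\<phi> u))\<^sup>2 = N u)"

text \<open>Projective lines over \<open>\<complex>\<close> and over the quaternions. Scalars act on the right, so that left
  multiplications, which are the transition functions, are linear over the scalars.\<close>

definition right_line :: "('k \<Rightarrow> 'k \<Rightarrow> 'k) \<Rightarrow> 'k \<times> 'k \<Rightarrow> ('k \<times> 'k) set" where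
  "right_line mulK z = {(mulK (fst z) a, mulK (snd z) a) | a. True}"

definition proj_line :: "('k::euclidean_space \<Rightarrow> 'k \<Rightarrow> 'k) \<Rightarrow> ('k \<times> 'k) set topology" where
  "proj_line mulK = quotient_topology (top_of_set (- {0})) (right_line mulK)"

definition tautological_bundle ::
    "('k::euclidean_space \<Rightarrow> 'k \<Rightarrow> 'k) \<Rightarrow> (('k \<times> 'k) set \<times> ('k \<times> 'k)) topology" where
  "tautological_bundle mulK =
     subtopology (prod_topology (proj_line mulK) euclidean) {(l, v). v \<in> l}"

text \<open>The identification of $S^d$ with the projective line by stereographic projection from the
  pole \<open>t = 1\<close>, which corresponds to the line $[0:1]$; an equatorial point \<open>u\<close> corresponds to $[1:u]$.
  The map \<open>h\<close> identifies \<open>real^'n\<close> with the algebra.\<close>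

definition stereo_line ::
    "('k::euclidean_space \<Rightarrow> 'k \<Rightarrow> 'k) \<Rightarrow> 'k \<Rightarrow> (real^'n \<Rightarrow> 'k) \<Rightarrow> (real^'n) \<times> real \<Rightarrow> ('k \<times> 'k) set" where
  "stereo_line mulK oneK h p =
     (if snd p = 1 then right_line mulK (0, oneK)
      else right_line mulK (oneK, (1 / (1 - snd p)) *\<^sub>R h (fst p)))"

text \<open>The bundle clutched by \<open>cl\<close> is isomorphic, as a real vector bundle, to the tautological
  bundle, over the above identification of the bases.\<close>

definition real_clutching_of_tautological ::
    "('k::euclidean_space \<Rightarrow> 'k \<Rightarrow> 'k) \<Rightarrow> 'k \<Rightarrow> (real^'n \<Rightarrow> 'k) \<Rightarrow> (real^'n \<Rightarrow> real^'n^'n) \<Rightarrow> bool" where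
  "real_clutching_of_tautological mulK oneK h cl \<longleftrightarrow>
     homeomorphic_map (top_of_set (sphere 0 1)) (proj_line mulK) (stereo_line mulK oneK h) \<and>
     (\<exists>F. homeomorphic_map (clutched_bundle cl) (tautological_bundle mulK) F \<and>
       (\<forall>s. \<forall>p \<in> hemisphere s.
          (\<forall>w. fst (F (clutch_point cl (s, p, w))) = stereo_line mulK oneK h p) \<and>
          linear (\<lambda>w. snd (F (clutch_point cl (s, p, w))))))"

text \<open>The octonionic Hopf fibration $S^{15}\to S^8$ sends $(x,y)$ to the stereographic image of
  $y x^{-1}$.\<close>

definition oct_hopf :: "oct \<times> oct \<Rightarrow> oct \<times> real" where
  "oct_hopf z = (2 *\<^sub>R oct_mult (snd z) (oct_cnj (fst z)), (norm (snd z))\<^sup>2 - (norm (fst z))\<^sup>2)"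

definition unit_sphere_bundle ::
    "(real^'n \<Rightarrow> real^'n^'n) \<Rightarrow> (bool \<times> ((real^'n) \<times> real) \<times> (real^'n)) set topology" where
  "unit_sphere_bundle cl =
     subtopology (clutched_bundle cl)
       {clutch_point cl (s, p, w) | s p w. p \<in> hemisphere s \<and> norm w = 1}"

text \<open>The unit sphere bundle of the clutched bundle is the octonionic Hopf fibration, over the
  identification \<open>(x, t) \<mapsto> (h x, t)\<close> of the base spheres, by an isomorphism which on each fibre is
  the restriction of a linear map.\<close>

definition octonionic_hopf_clutching ::
    "(real^'n \<Rightarrow> oct) \<Rightarrow> (real^'n \<Rightarrow> real^'n^'n) \<Rightarrow> bool" where
  "octonionic_hopf_clutching h cl \<longleftrightarrow>
     homeomorphic_map (top_of_set (sphere 0 1)) (top_of_set (sphere 0 1))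
       (\<lambda>p. (h (fst p), snd p :: real)) \<and>
     (\<exists>F. homeomorphic_map (unit_sphere_bundle cl) (top_of_set (sphere 0 1)) F \<and>
       (\<forall>s. \<forall>p \<in> hemisphere s.
          (\<forall>w. norm w = 1 \<longrightarrow> oct_hopf (F (clutch_point cl (s, p, w))) = (h (fst p), snd p)) \<and>
          (\<exists>f. linear f \<and> (\<forall>w. norm w = 1 \<longrightarrow> F (clutch_point cl (s, p, w)) = f w))))"

end

theory Submission
  imports Defs
begin

text \<open>
  Polarizing the multiplicativity of the norm of a composition algebra yields a conjugation with
  \<open>conjugate u \<odot> (u \<odot> v) = (norm u)\<^sup>2 v\<close>. Hence left multiplication \<open>L\<^sub>u\<close> is \<open>norm u\<close> times an orthogonal map
  and, for \<open>u \<noteq> 0\<close>, is inverted by the left multiplication by \<open>conjugate u / (norm u)\<^sup>2\<close>, which depends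
  continuously on \<open>u\<close>. Since the nonzero vectors are connected and \<open>L\<^sub>1\<close> is the identity, the determinant
  of \<open>L\<^sub>u\<close> is positive.

  The affine coordinate \<open>q\<^sub>i\<close> vanishes only at the coordinate point \<open>P\<^sub>i\<close>, which lies in no other chart.
  So the matrices \<open>M\<^sub>i\<close> are invertible wherever they enter the transition functions \<open>M\<^sub>i M\<^sub>j\<inverse>\<close>, which
  therefore form a continuous cocycle. The local frames and \<open>\<tau>\<close> are given in each chart by continuous
  families of invertible matrices, and every such map of a glued bundle is a trivialization
  (\<open>is_trivializationI\<close>). Comparing \<open>w = M\<^sub>j\<inverse> w\<^sub>j\<close> with \<open>w\<^sub>i = M\<^sub>i M\<^sub>j\<inverse> w\<^sub>j\<close> gives \<open>w\<^sub>i = M\<^sub>i w\<close>, which is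
  the clutching map (\<open>clutching_map_tau\<close>). The boundary of a coordinate ball is a sphere of some radius
  \<open>\<rho>\<close> in its chart (\<open>chart_ball_frontier\<close>), on which \<open>M\<^sub>i\<close> is \<open>\<rho>\<close> times \<open>L\<^sub>u\<close> for the normalized point \<open>u\<close>,
  and deforming the factor linearly to \<open>1\<close> is the required homotopy.

  For the Hopf bundles, the vectors \<open>z = (a, b)\<close> with \<open>hopf_map z = (norm z)\<^sup>2 (x, t)\<close> form a linear fibre
  over the point \<open>(x, t)\<close> of the sphere. It is parametrized by \<open>a\<close> over the lower hemisphere and by \<open>b\<close>
  over the upper one (\<open>hopf_frame\<close>), and over the equator the two parametrizations differ by the left
  multiplication by \<open>x\<close> (\<open>hopf_frame_equator\<close>). The bundle clutched by left multiplication is therefore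
  the bundle of these fibres. Its unit vectors fill the unit sphere of pairs, and the bundle projection
  becomes the Hopf map: this is the octonionic case. In an associative algebra the fibres are the lines
  spanned by a vector under multiplication from the right, so the bundle is the tautological bundle:
  these are the complex and the quaternionic cases.
\<close>

section \<open>Euclidean composition algebras\<close>

text \<open>The norm is the Euclidean norm of the type, so that the complex numbers, quaternions and
  octonions, and every composition algebra carried over to a coordinate space, are instances. As the
  octonions are among them, products of three factors are always rearranged with the adjunctions for
  left and right multiplication proved below.\<close>

locale euclidean_composition_algebra =
  fixes mul :: "'k::euclidean_space \<Rightarrow> 'k \<Rightarrow> 'k" (infixl \<open>\<odot>\<close> 70) and one :: 'k
  assumes bilinear_mul: "bilinear mul"
    and one_mul [simp]: "one \<odot> u = u"
    and mul_one [simp]: "u \<odot> one = u"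
    and norm_mul: "norm (u \<odot> v) = norm u * norm v"
begin

lemmas mul_simps = bilinear_ladd [OF bilinear_mul] bilinear_radd [OF bilinear_mul]
  bilinear_lsub [OF bilinear_mul] bilinear_rsub [OF bilinear_mul]
  bilinear_lmul [OF bilinear_mul] bilinear_rmul [OF bilinear_mul]
  bilinear_lneg [OF bilinear_mul] bilinear_rneg [OF bilinear_mul]
  bilinear_lzero [OF bilinear_mul] bilinear_rzero [OF bilinear_mul]

lemma linear_mul: "linear (mul u)"
  using bilinear_mul by (simp add: bilinear_def)

lemma bounded_bilinear_mul: "bounded_bilinear mul"
  using bilinear_mul bilinear_conv_bounded_bilinear by blast

lemmas continuous_on_mul [continuous_intros] = bounded_bilinear.continuous_on [OF bounded_bilinear_mul]

lemma norm_one [simp]: "norm one = 1"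
proof -
  obtain a :: 'k where "a \<noteq> 0"
    using nonzero_Basis nonempty_Basis by blast
  then show ?thesis
    using norm_mul [of one a] by simp
qed

lemma one_neq_0 [simp]: "one \<noteq> (0::'k)"
  using norm_one by force

text \<open>The linear map that fixes the unit and is \<open>-1\<close> on its orthogonal complement.\<close>

definition conjugate :: "'k \<Rightarrow> 'k" where
  "conjugate u = (2 * (u \<bullet> one)) *\<^sub>R one - u"

lemma linear_conj: "linear conjugate"
  by (rule linearI) (simp_all add: conjugate_def algebra_simps scaleR_add_left)

lemma conj_conj [simp]: "conjugate (conjugate u) = u"
  by (simp add: conjugate_def algebra_simps norm_eq_1 [THEN iffD1, OF norm_one])

lemma inner_conj: "conjugate u \<bullet> v = u \<bullet> conjugate v"
  by (simp add: conjugate_def inner_diff_left inner_diff_right inner_commute)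

lemma norm_conj [simp]: "norm (conjugate u) = norm u"
  using inner_conj [of u "conjugate u"] by (simp add: norm_eq_sqrt_inner)

text \<open>Polarization of the multiplicativity of the norm in the second factor. Polarizing the result
  in the first factor gives the exchange law that follows, from which everything else is read off by
  putting the unit in one of the four places.\<close>

lemma inner_mul_mul_left: "(a \<odot> b) \<bullet> (a \<odot> c) = (norm a)\<^sup>2 * (b \<bullet> c)"
proof -
  have "(norm (a \<odot> b + a \<odot> c))\<^sup>2 = (norm a)\<^sup>2 * (norm (b + c))\<^sup>2"
    by (simp add: norm_mul power_mult_distrib flip: bilinear_radd [OF bilinear_mul])
  then show ?thesis
    by (simp only: power2_norm_eq_inner inner_add_left inner_add_right
        norm_mul power_mult_distrib algebra_simps)
       (simp add: inner_commute norm_mul power_mult_distrib flip: power2_norm_eq_inner)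
qed

lemma inner_mul_exchange:
  "(a \<odot> c) \<bullet> (b \<odot> d) + (a \<odot> d) \<bullet> (b \<odot> c) = 2 * (a \<bullet> b) * (c \<bullet> d)"
  using inner_mul_mul_left [of "a + b" c d] inner_mul_mul_left [of a c d] inner_mul_mul_left [of b c d]
  by (simp add: mul_simps power2_norm_eq_inner inner_add_left inner_add_right inner_commute algebra_simps)

lemma inner_mul_left: "(a \<odot> c) \<bullet> d = c \<bullet> (conjugate a \<odot> d)"
  using inner_mul_exchange [of a c one d]
  by (simp add: conjugate_def mul_simps inner_diff_right inner_commute algebra_simps)

lemma inner_mul_right: "(c \<odot> a) \<bullet> d = c \<bullet> (d \<odot> conjugate a)"
  using inner_mul_exchange [of c a d one]
  by (simp add: conjugate_def mul_simps inner_diff_right inner_commute algebra_simps)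

text \<open>The substitute for associativity: tested against \<open>c\<close>, the left-hand side is the inner product of
  \<open>a \<odot> b\<close> and \<open>a \<odot> c\<close>. In particular, left multiplication by \<open>a \<noteq> 0\<close> has the inverse
  \<open>b \<mapsto> (conjugate a \<odot> b) / (norm a)\<^sup>2\<close>.\<close>

lemma conj_mul_mul: "conjugate a \<odot> (a \<odot> b) = (norm a)\<^sup>2 *\<^sub>R b"
proof (rule vector_eq_rdot [THEN iffD1], rule allI)
  fix c
  show "(conjugate a \<odot> (a \<odot> b)) \<bullet> c = ((norm a)\<^sup>2 *\<^sub>R b) \<bullet> c"
    using inner_mul_mul_left [of a b c] inner_mul_left [of "conjugate a" "a \<odot> b" c] by simp
qed

lemma mul_conj_mul: "a \<odot> (conjugate a \<odot> b) = (norm a)\<^sup>2 *\<^sub>R b"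
  using conj_mul_mul [of "conjugate a" b] by simp

text \<open>Three adjunctions move the factors of an inner product to the other side.\<close>

lemma conj_mul: "conjugate (a \<odot> b) = conjugate b \<odot> conjugate a"
proof (rule vector_eq_rdot [THEN iffD1], rule allI)
  fix c
  have "conjugate (a \<odot> b) \<bullet> c = b \<bullet> (conjugate a \<odot> conjugate c)"
    by (simp add: inner_conj inner_mul_left)
  also have "\<dots> = (b \<odot> c) \<bullet> conjugate a"
    by (simp add: inner_mul_right)
  also have "\<dots> = (conjugate b \<odot> conjugate a) \<bullet> c"
    using inner_mul_left [of b c "conjugate a"] by (simp add: inner_commute)
  finally show "conjugate (a \<odot> b) \<bullet> c = (conjugate b \<odot> conjugate a) \<bullet> c" .
qed

lemma mul_mul_conj: "(b \<odot> a) \<odot> conjugate a = (norm a)\<^sup>2 *\<^sub>R b"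
proof -
  have "conjugate ((b \<odot> a) \<odot> conjugate a) = conjugate ((norm a)\<^sup>2 *\<^sub>R b)"
    by (simp add: conj_mul mul_conj_mul linear_scale [OF linear_conj])
  then show ?thesis
    by (metis conj_conj)
qed

lemma mul_conj_mul': "(b \<odot> conjugate a) \<odot> a = (norm a)\<^sup>2 *\<^sub>R b"
  using mul_mul_conj [of b "conjugate a"] by simp

section \<open>The Hopf map and its fibres\<close>

text \<open>For a unit vector \<open>(a, b)\<close> with \<open>a \<noteq> 0\<close> this is the point of the sphere whose stereographic
  projection from the pole \<open>t = 1\<close> is the quotient of \<open>b\<close> by \<open>a\<close>.\<close>

definition hopf_map :: "'k \<times> 'k \<Rightarrow> 'k \<times> real" where
  "hopf_map z = (2 *\<^sub>R (snd z \<odot> conjugate (fst z)), (norm (snd z))\<^sup>2 - (norm (fst z))\<^sup>2)"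

text \<open>The linear fibre of the Hopf map over a point \<open>(x, t)\<close>, which its unit vectors span, consists of the
  vectors \<open>(w, y \<odot> w)\<close> with
  \<open>y = x / (1 - t)\<close>, as long as \<open>t \<noteq> 1\<close>, and of the vectors \<open>(y' \<odot> w, w)\<close> with
  \<open>y' = conjugate x / (1 + t)\<close>, as long as \<open>t \<noteq> -1\<close>. Each parametrization is used on the hemisphere
  that avoids its exceptional pole. The factors under the square root make it isometric in \<open>w\<close>, and
  they agree on the equator.\<close>

definition hopf_frame :: "bool \<Rightarrow> 'k \<times> real \<Rightarrow> 'k \<Rightarrow> 'k \<times> 'k" where
  "hopf_frame s p w =
     (if s then sqrt ((1 + snd p) / 2) *\<^sub>R ((1 / (1 + snd p)) *\<^sub>R (conjugate (fst p) \<odot> w), w)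
      else sqrt ((1 - snd p) / 2) *\<^sub>R (w, (1 / (1 - snd p)) *\<^sub>R (fst p \<odot> w)))"

definition hopf_coord :: "bool \<Rightarrow> 'k \<times> real \<Rightarrow> 'k \<times> 'k \<Rightarrow> 'k" where
  "hopf_coord s p z =
     (if s then (1 / sqrt ((1 + snd p) / 2)) *\<^sub>R snd z else (1 / sqrt ((1 - snd p) / 2)) *\<^sub>R fst z)"

definition half_sphere :: "bool \<Rightarrow> ('k \<times> real) set" where
  "half_sphere s = {p \<in> sphere 0 1. if s then snd p \<ge> 0 else snd p \<le> 0}"

lemma sphere_prod_iff: "(x, t) \<in> sphere 0 1 \<longleftrightarrow> (norm x)\<^sup>2 + (norm t)\<^sup>2 = 1"
  for x :: "'c::real_normed_vector" and t :: "'d::real_normed_vector"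
  by (simp add: norm_Pair)

lemma linear_hopf_frame: "linear (hopf_frame s p)"
  by (rule linearI) (auto simp: hopf_frame_def mul_simps algebra_simps)

lemma hopf_coord_frame:
  assumes "p \<in> half_sphere s"
  shows "hopf_coord s p (hopf_frame s p w) = w"
  using assms by (cases p) (auto simp: hopf_coord_def hopf_frame_def half_sphere_def)

lemma norm_hopf_frame:
  assumes "p \<in> half_sphere s"
  shows "norm (hopf_frame s p w) = norm w"
proof -
  obtain x t where p: "p = (x, t)" by (cases p)
  have x: "(norm x)\<^sup>2 = (1 + t) * (1 - t)"
    using assms by (simp add: half_sphere_def p norm_Pair algebra_simps power2_eq_square)
  \<comment> \<open>to be used with \<open>r = 1 + t\<close>, \<open>y = 1 - t\<close> and with the signs exchanged, as \<open>(norm x)\<^sup>2 = (1 + t) (1 - t)\<close>\<close>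
  have cancel: "r / 2 * ((1 / r)\<^sup>2 * (r * y) * W + W) = W" if "r \<noteq> 0" "r + y = 2" for r y W :: real
  proof -
    have "r / 2 * ((1 / r)\<^sup>2 * (r * y) * W + W) = (r + y) / 2 * W"
      using that(1) by (simp add: power2_eq_square field_simps)
    then show ?thesis using that(2) by simp
  qed
  have "(norm (hopf_frame s p w))\<^sup>2 = (norm w)\<^sup>2"
  proof (cases s)
    case True
    then have t: "1 + t > 0" using assms by (simp add: half_sphere_def p)
    have "(norm (hopf_frame s p w))\<^sup>2
        = (1 + t) / 2 * ((1 / (1 + t))\<^sup>2 * ((1 + t) * (1 - t)) * (norm w)\<^sup>2 + (norm w)\<^sup>2)"
      unfolding x [symmetric] using True t
      by (simp add: hopf_frame_def p norm_Pair power_mult_distrib power_divide norm_mul distrib_left del: scaleR_Pair)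
    also have "\<dots> = (norm w)\<^sup>2"
      using t cancel [of "1 + t" "1 - t"] by simp
    finally show ?thesis .
  next
    case False
    then have t: "1 - t > 0" using assms by (simp add: half_sphere_def p)
    have "(norm (hopf_frame s p w))\<^sup>2
        = (1 - t) / 2 * ((norm w)\<^sup>2 + (1 / (1 - t))\<^sup>2 * ((1 + t) * (1 - t)) * (norm w)\<^sup>2)"
      unfolding x [symmetric] using False t
      by (simp add: hopf_frame_def p norm_Pair power_mult_distrib power_divide norm_mul distrib_left del: scaleR_Pair)
    also have "\<dots> = (norm w)\<^sup>2"
      using t cancel [of "1 - t" "1 + t"] by (simp add: mult.commute [of "1 + t"] add.commute)
    finally show ?thesis .
  qed
  then show ?thesis
    by (simp add: power2_eq_iff_nonneg)
qed

lemma hopf_map_frame: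
  assumes "p \<in> half_sphere s"
  shows "hopf_map (hopf_frame s p w) = (norm w)\<^sup>2 *\<^sub>R p"
proof -
  obtain x t where p: "p = (x, t)" by (cases p)
  have x: "(norm x)\<^sup>2 = (1 + t) * (1 - t)"
    using assms by (simp add: half_sphere_def p norm_Pair algebra_simps power2_eq_square)
  \<comment> \<open>to be used with \<open>r = 1 + t\<close>, \<open>y = 1 - t\<close> and with the signs exchanged, as \<open>(norm x)\<^sup>2 = (1 + t) (1 - t)\<close>\<close>
  have cancel: "r / 2 * ((1 / r)\<^sup>2 * (r * y)) = y / 2" if "r \<noteq> 0" for r y :: real
    using that by (simp add: power2_eq_square)
  show ?thesis
  proof (cases s)
    case True
    then have t: "1 + t > 0" using assms by (simp add: half_sphere_def p)
    have c: "(1 + t) / 2 * (1 / (1 + t)) = 1 / 2" "(1 + t) / 2 * ((1 / (1 + t))\<^sup>2 * ((1 + t) * (1 - t))) = (1 - t) / 2"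
      using t cancel [of "1 + t" "1 - t"] by simp_all
    have "2 *\<^sub>R (snd (hopf_frame s p w) \<odot> conjugate (fst (hopf_frame s p w)))
      = (2 * ((1 + t) / 2 * (1 / (1 + t)))) *\<^sub>R (w \<odot> (conjugate w \<odot> x))"
      using True t
      by (simp add: hopf_frame_def p mul_simps linear_scale [OF linear_conj] conj_mul)
    moreover have "(norm (snd (hopf_frame s p w)))\<^sup>2 - (norm (fst (hopf_frame s p w)))\<^sup>2
      = ((1 + t) / 2 - (1 + t) / 2 * ((1 / (1 + t))\<^sup>2 * ((1 + t) * (1 - t)))) * (norm w)\<^sup>2"
      unfolding x [symmetric] using True t
      by (simp add: hopf_frame_def p norm_mul power_mult_distrib power_divide left_diff_distrib)
    ultimately show ?thesis
      unfolding c by (simp add: hopf_map_def p mul_conj_mul diff_divide_distrib add_divide_distrib)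
  next
    case False
    then have t: "1 - t > 0" using assms by (simp add: half_sphere_def p)
    have c: "(1 - t) / 2 * (1 / (1 - t)) = 1 / 2" "(1 - t) / 2 * ((1 / (1 - t))\<^sup>2 * ((1 + t) * (1 - t))) = (1 + t) / 2"
      using t cancel [of "1 - t" "1 + t"] by (simp_all add: mult.commute [of "1 + t"])
    have "2 *\<^sub>R (snd (hopf_frame s p w) \<odot> conjugate (fst (hopf_frame s p w)))
      = (2 * ((1 - t) / 2 * (1 / (1 - t)))) *\<^sub>R ((x \<odot> w) \<odot> conjugate w)"
      using False t
      by (simp add: hopf_frame_def p mul_simps linear_scale [OF linear_conj])
    moreover have "(norm (snd (hopf_frame s p w)))\<^sup>2 - (norm (fst (hopf_frame s p w)))\<^sup>2
      = ((1 - t) / 2 * ((1 / (1 - t))\<^sup>2 * ((1 + t) * (1 - t))) - (1 - t) / 2) * (norm w)\<^sup>2"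
      unfolding x [symmetric] using False t
      by (simp add: hopf_frame_def p norm_mul power_mult_distrib power_divide left_diff_distrib)
    ultimately show ?thesis
      unfolding c by (simp add: hopf_map_def p mul_mul_conj diff_divide_distrib add_divide_distrib)
  qed
qed

lemma hopf_map_in_sphere:
  assumes "z \<in> sphere 0 1"
  shows "hopf_map z \<in> sphere 0 1"
proof -
  obtain a b where z: "z = (a, b)" by (cases z)
  have "(norm a)\<^sup>2 + (norm b)\<^sup>2 = 1"
    using assms sphere_prod_iff z by blast
  then have "((norm a)\<^sup>2 + (norm b)\<^sup>2)\<^sup>2 = 1"
    by simp
  then have "4 * ((norm b)\<^sup>2 * (norm a)\<^sup>2) + ((norm b)\<^sup>2 - (norm a)\<^sup>2)\<^sup>2 = 1"
    by (simp add: power2_sum power2_diff)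
  then show ?thesis
    unfolding hopf_map_def z sphere_prod_iff by (simp add: norm_mul power_mult_distrib)
qed

text \<open>For the base point \<open>(x, t)\<close> of a unit vector \<open>(a, b)\<close> one has \<open>1 + t = 2 (norm b)\<^sup>2\<close> and
  \<open>1 - t = 2 (norm a)\<^sup>2\<close>. So the coordinate that serves as parameter is nonzero on its hemisphere, and
  \<open>(b \<odot> conjugate a) \<odot> a = (norm a)\<^sup>2 b\<close>, or the same with \<open>a\<close> and \<open>b\<close> exchanged, recovers the other one.\<close>

lemma hopf_frame_coord:
  assumes z: "z \<in> sphere 0 1" and s: "hopf_map z \<in> half_sphere s"
  shows "hopf_frame s (hopf_map z) (hopf_coord s (hopf_map z) z) = z"
proof -
  obtain a b where ab: "z = (a, b)" by (cases z)
  have n: "(norm a)\<^sup>2 + (norm b)\<^sup>2 = 1"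
    using z sphere_prod_iff ab by blast
  show ?thesis
  proof (cases s)
    case True
    have t: "1 + snd (hopf_map z) = 2 * (norm b)\<^sup>2"
      using n by (simp add: hopf_map_def ab)
    then have "b \<noteq> 0" using s True by (auto simp: half_sphere_def)
    with True show ?thesis
      unfolding hopf_frame_def hopf_coord_def t
      by (simp add: hopf_map_def ab linear_scale [OF linear_conj] conj_mul mul_simps mul_conj_mul')
  next
    case False
    have t: "1 - snd (hopf_map z) = 2 * (norm a)\<^sup>2"
      using n by (simp add: hopf_map_def ab)
    then have "a \<noteq> 0" using s False by (auto simp: half_sphere_def)
    with False show ?thesis
      unfolding hopf_frame_def hopf_coord_def t
      by (simp add: hopf_map_def ab mul_simps mul_conj_mul')
  qed
qed

text \<open>Over the equator the two parametrizations of a fibre differ by left multiplication by the base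
  point. This is the reason why left multiplication is the clutching map of the Hopf bundle.\<close>

lemma hopf_frame_equator:
  assumes "norm x = 1"
  shows "hopf_frame True (x, 0) (x \<odot> w) = hopf_frame False (x, 0) w"
  using assms by (simp add: hopf_frame_def conj_mul_mul)

lemma continuous_on_conj [continuous_intros]:
  "continuous_on S f \<Longrightarrow> continuous_on S (\<lambda>x. conjugate (f x))"
  unfolding conjugate_def by (intro continuous_intros)

lemma continuous_on_hopf_frame:
  "continuous_on (half_sphere s \<times> UNIV) (\<lambda>z. hopf_frame s (fst z) (snd z))"
  by (cases s) (auto simp: hopf_frame_def half_sphere_def intro!: continuous_intros)

lemma continuous_on_hopf_coord:
  "continuous_on (half_sphere s \<times> UNIV) (\<lambda>z. hopf_coord s (fst z) (snd z))"
  by (cases s) (auto simp: hopf_coord_def half_sphere_def intro!: continuous_intros)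

lemma continuous_on_hopf_map: "continuous_on S hopf_map"
  unfolding hopf_map_def [abs_def] by (intro continuous_intros)

end

section \<open>Quotients of disjoint unions and glued bundles\<close>

lemma continuous_map_sum_topology:
  assumes "\<And>i. i \<in> I \<Longrightarrow> continuous_map (X i) Z (\<lambda>x. f (i, x))"
  shows "continuous_map (sum_topology X I) Z f"
  unfolding continuous_map_def
proof (intro conjI allI impI)
  show "f \<in> topspace (sum_topology X I) \<rightarrow> topspace Z"
    using assms by (force simp: continuous_map_def)
  fix U assume "openin Z U"
  then have "openin (X i) {x \<in> topspace (X i). f (i, x) \<in> U}" if "i \<in> I" for i
    using assms [OF that] by (auto intro: openin_continuous_map_preimage)
  then show "openin (sum_topology X I) {x \<in> topspace (sum_topology X I). f x \<in> U}"
    by (auto simp: openin_sum_topology)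
qed

text \<open>Glued spaces are compared with a target piece by piece. The open case serves the standard cover
  of the projective space, the closed case serves the two hemispheres of a sphere.\<close>

lemma quotient_map_sum_topology_pieces:
  assumes hom: "\<And>i. i \<in> I \<Longrightarrow> homeomorphic_map (X i) (subtopology Z (Y i)) (\<lambda>x. f (i, x))"
    and cover: "topspace Z \<subseteq> (\<Union>i\<in>I. Y i)"
    and oc: "(\<forall>i\<in>I. openin Z (Y i)) \<or> finite I \<and> (\<forall>i\<in>I. closedin Z (Y i))"
  shows "quotient_map (sum_topology X I) Z f"
proof -
  have im: "(\<lambda>x. f (i, x)) ` topspace (X i) = topspace Z \<inter> Y i" if "i \<in> I" for i
    using homeomorphic_imp_surjective_map [OF hom [OF that]] by simp
  have img: "f ` U = (\<Union>i\<in>I. (\<lambda>x. f (i, x)) ` {x. (i, x) \<in> U})"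
    if "U \<subseteq> Sigma I (topspace \<circ> X)" for U
    using that by force
  have cont: "continuous_map (sum_topology X I) Z f"
    using homeomorphic_imp_continuous_map [OF hom]
    by (intro continuous_map_sum_topology) (simp add: continuous_map_in_subtopology)
  have surj: "f ` topspace (sum_topology X I) = topspace Z"
  proof -
    have "f ` topspace (sum_topology X I) = (\<Union>i\<in>I. topspace Z \<inter> Y i)"
      using im by (subst img) auto
    with cover show ?thesis by auto
  qed
  from oc show ?thesis
  proof
    assume op: "\<forall>i\<in>I. openin Z (Y i)"
    have "open_map (sum_topology X I) Z f"
      unfolding open_map_def
    proof (intro allI impI)
      fix U assume U: "openin (sum_topology X I) U"
      have "openin Z ((\<lambda>x. f (i, x)) ` {x. (i, x) \<in> U})" if "i \<in> I" for i
      proof (rule openin_trans_full)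
        show "openin (subtopology Z (Y i)) ((\<lambda>x. f (i, x)) ` {x. (i, x) \<in> U})"
          using homeomorphic_imp_open_map [OF hom [OF that]] U that
          by (simp add: open_map_def openin_sum_topology)
      qed (use op that in blast)
      then show "openin Z (f ` U)"
        using img U by (auto simp: openin_sum_topology)
    qed
    from continuous_open_imp_quotient_map [OF cont this surj] show ?thesis .
  next
    assume cl: "finite I \<and> (\<forall>i\<in>I. closedin Z (Y i))"
    have "closed_map (sum_topology X I) Z f"
      unfolding closed_map_def
    proof (intro allI impI)
      fix U assume U: "closedin (sum_topology X I) U"
      have "closedin Z ((\<lambda>x. f (i, x)) ` {x. (i, x) \<in> U})" if "i \<in> I" for i
      proof (rule closedin_trans_full)
        show "closedin (subtopology Z (Y i)) ((\<lambda>x. f (i, x)) ` {x. (i, x) \<in> U})"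
          using homeomorphic_imp_closed_map [OF hom [OF that]] U that
          by (simp add: closed_map_def closedin_sum_topology)
      qed (use cl that in blast)
      then have "closedin Z (\<Union>i\<in>I. (\<lambda>x. f (i, x)) ` {x. (i, x) \<in> U})"
        using cl by (intro closedin_Union) auto
      then show "closedin Z (f ` U)"
        using img U by (simp add: closedin_sum_topology)
    qed
    from continuous_closed_imp_quotient_map [OF cont this surj] show ?thesis .
  qed
qed

text \<open>The inverse map need not be exhibited: a map whose composition with a quotient map is a quotient
  map is itself one, and an injective quotient map is a homeomorphism.\<close>

lemma homeomorphic_map_from_quotient:
  assumes q: "quotient_map X Y q" and f: "quotient_map X Z (f \<circ> q)" and inj: "inj_on f (topspace Y)"
  shows "homeomorphic_map Y Z f"
proof -
  have "quotient_map Y Z f"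
    using q f quotient_map_compose_eq by blast
  with inj show ?thesis
    by (simp add: homeomorphic_map_def)
qed

lemma continuous_on_matrix_vector_mult: "continuous_on S (\<lambda>z. fst z *v snd z)"
  for S :: "((real^'n^'m) \<times> (real^'n)) set"
  unfolding matrix_vector_mult_def by (intro continuous_intros)

lemma continuous_map_matrix_vector_mult:
  fixes A :: "'x \<Rightarrow> real^'n^'m" and v :: "'x \<Rightarrow> real^'n"
  assumes A: "continuous_map X euclidean A" and v: "continuous_map X euclidean v"
  shows "continuous_map X euclidean (\<lambda>x. A x *v v x)"
proof -
  have "continuous_map X euclidean (\<lambda>x. (A x, v x))"
    using A v by (simp add: continuous_map_pairwise o_def flip: prod_topology_euclidean)
  moreover have "continuous_map euclidean euclidean (\<lambda>z :: (real^'n^'m) \<times> (real^'n). fst z *v snd z)"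
    by (simp add: continuous_on_matrix_vector_mult)
  ultimately have "continuous_map X euclidean ((\<lambda>z. fst z *v snd z) \<circ> (\<lambda>x. (A x, v x)))"
    by (rule continuous_map_compose)
  then show ?thesis by (simp add: o_def)
qed

locale bundle_gluing =
  fixes X :: "'b topology" and U :: "'i \<Rightarrow> 'b set" and g :: "'i \<Rightarrow> 'i \<Rightarrow> 'b \<Rightarrow> real^'n^'n"
  assumes subset_base: "U i \<subseteq> topspace X"
    and transition_refl: "p \<in> U i \<Longrightarrow> g i i p = mat 1"
    and transition_cocycle: "\<lbrakk>p \<in> U i; p \<in> U j; p \<in> U k\<rbrakk> \<Longrightarrow> g i j p ** g j k p = g i k p"
begin

lemma transition_apply: "\<lbrakk>p \<in> U i; p \<in> U j; p \<in> U k\<rbrakk> \<Longrightarrow> g i j p *v (g j k p *v w) = g i k p *v w"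
  by (simp add: matrix_vector_mul_assoc transition_cocycle)

lemma transition_flip: "\<lbrakk>p \<in> U i; p \<in> U j\<rbrakk> \<Longrightarrow> v = g i j p *v w \<longleftrightarrow> w = g j i p *v v"
  by (auto simp: transition_apply transition_refl)

lemma mem_glue_point: "(j, p', w) \<in> glue_point U g (i, p, v) \<longleftrightarrow> p = p' \<and> p \<in> U i \<inter> U j \<and> v = g i j p *v w"
  by (auto simp: glue_point_def glue_rel_def)

text \<open>By the cocycle condition the identifications are symmetric and transitive, so two triples have the
  same class exactly when they are identified directly.\<close>

lemma glue_point_eq_iff:
  assumes "p \<in> U i" "p' \<in> U j"
  shows "glue_point U g (i, p, v) = glue_point U g (j, p', w) \<longleftrightarrow> p = p' \<and> v = g i j p *v w"
proof
  assume "glue_point U g (i, p, v) = glue_point U g (j, p', w)"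
  moreover have "(j, p', w) \<in> glue_point U g (j, p', w)"
    using assms by (simp add: mem_glue_point transition_refl)
  ultimately show "p = p' \<and> v = g i j p *v w"
    using mem_glue_point by blast
next
  assume v: "p = p' \<and> v = g i j p *v w"
  then have w: "w = g j i p *v v"
    using assms transition_flip by blast
  have "z \<in> glue_point U g (i, p, v) \<longleftrightarrow> z \<in> glue_point U g (j, p', w)" for z
  proof (cases z)
    case (fields k p'' u)
    with v w assms show ?thesis
      by (auto simp: mem_glue_point transition_apply)
  qed
  then show "glue_point U g (i, p, v) = glue_point U g (j, p', w)" by blast
qed

lemma glue_proj_point: "p \<in> U i \<Longrightarrow> glue_proj (glue_point U g (i, p, v)) = p"
  unfolding glue_proj_def
  by (rule the_equality) (auto simp: mem_glue_point intro!: exI [of _ i] exI [of _ v] simp: transition_refl)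

lemma glue_coord_point:
  "\<lbrakk>p \<in> U i; p \<in> U j\<rbrakk> \<Longrightarrow> glue_coord j (glue_point U g (i, p, v)) = g j i p *v v"
  unfolding glue_coord_def
  by (rule the_equality) (auto simp: mem_glue_point transition_flip [of p i j])

lemma topspace_glued_bundle: "topspace (glued_bundle X U g) = {glue_point U g (i, p, w) | i p w. p \<in> U i}"
  using subset_base by (fastforce simp: glued_bundle_def topspace_quotient_topology image_iff)

lemma topspace_restricted_bundle:
  "topspace (restricted_bundle X U g A) = {glue_point U g (i, p, w) | i p w. p \<in> U i \<inter> A}"
proof (intro set_eqI iffI)
  fix c assume "c \<in> topspace (restricted_bundle X U g A)"
  then obtain i p w where "c = glue_point U g (i, p, w)" "p \<in> U i" "glue_proj c \<in> A"
    by (auto simp: restricted_bundle_def topspace_glued_bundle)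
  then show "c \<in> {glue_point U g (i, p, w) | i p w. p \<in> U i \<inter> A}"
    by (auto simp: glue_proj_point)
next
  fix c assume "c \<in> {glue_point U g (i, p, w) | i p w. p \<in> U i \<inter> A}"
  then show "c \<in> topspace (restricted_bundle X U g A)"
    by (auto simp: restricted_bundle_def topspace_glued_bundle glue_proj_point)
qed

lemma quotient_map_glued_bundle:
  "quotient_map (sum_topology (\<lambda>i. prod_topology (subtopology X (U i)) euclidean) UNIV)
     (glued_bundle X U g) (glue_point U g)"
  by (simp add: glued_bundle_def quotient_map_quotient_topology)

text \<open>Over an open set \<open>A\<close>, restricting commutes with gluing, because the part of the disjoint union that
  lies over \<open>A\<close> is open and saturated.\<close>

lemma quotient_map_restricted_bundle:
  assumes A: "openin X A"
  shows "quotient_map (sum_topology (\<lambda>i. prod_topology (subtopology X (U i \<inter> A)) euclidean) UNIV)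
     (restricted_bundle X U g A) (glue_point U g)"
proof -
  let ?S = "sum_topology (\<lambda>i. prod_topology (subtopology X (U i)) (euclidean :: (real^'n) topology)) UNIV"
  let ?P = "Sigma UNIV (\<lambda>i. (U i \<inter> A) \<times> (UNIV :: (real^'n) set))"
  let ?V = "{c \<in> topspace (glued_bundle X U g). glue_proj c \<in> A}"
  have pre: "{z \<in> topspace ?S. glue_point U g z \<in> ?V} = ?P"
  proof (rule set_eqI)
    fix z :: "'i \<times> 'b \<times> (real^'n)"
    obtain i p w where z: "z = (i, p, w)"
      by (cases z)
    show "z \<in> {z \<in> topspace ?S. glue_point U g z \<in> ?V} \<longleftrightarrow> z \<in> ?P"
      using subset_base [of i] by (auto simp: z topspace_glued_bundle glue_proj_point)
  qed
  have "openin ?S ?P"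
    using A by (auto simp: openin_disjoint_union openin_prod_Times_iff openin_subtopology_Int2)
  then have "openin (glued_bundle X U g) ?V"
    using quotient_map_glued_bundle [unfolded quotient_map_def, THEN conjunct2, THEN spec, of ?V]
    unfolding pre by (simp only: Collect_subset simp_thms)
  then have "quotient_map (subtopology ?S ?P) (subtopology (glued_bundle X U g) ?V) (glue_point U g)"
    using quotient_map_restriction [OF quotient_map_glued_bundle pre] by blast
  moreover have "subtopology ?S ?P = sum_topology (\<lambda>i. prod_topology (subtopology X (U i \<inter> A)) euclidean) UNIV"
    unfolding subtopology_sum_topology
    by (simp add: prod_topology_subtopology subtopology_subtopology Times_Int_Times Int_ac flip: subtopology_UNIV)
  moreover have "subtopology (glued_bundle X U g) ?V = restricted_bundle X U g A"
    unfolding restricted_bundle_def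
    using subtopology_restrict [of "glued_bundle X U g" "{c. glue_proj c \<in> A}"] by (simp add: Int_def)
  ultimately show ?thesis by simp
qed

text \<open>The criterion used for all trivializations here. If \<open>\<phi>\<close> is given over \<open>U i\<close> by a continuous family of
  matrices with a continuous family of inverses, it maps the part of the disjoint union over
  \<open>U i \<inter> A\<close> homeomorphically onto an open part of the product, and these parts cover the product.\<close>

lemma is_trivializationI:
  fixes h k :: "'i \<Rightarrow> 'b \<Rightarrow> real^'n^'n"
  assumes A: "openin X A" "A \<subseteq> (\<Union>i. U i)" and U: "\<And>i. openin X (U i)"
    and \<phi>: "\<And>i p w. p \<in> U i \<inter> A \<Longrightarrow> \<phi> (glue_point U g (i, p, w)) = (p, h i p *v w)"
    and hk: "\<And>i p. p \<in> U i \<inter> A \<Longrightarrow> h i p ** k i p = mat 1"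
    and h: "\<And>i. continuous_map (subtopology X (U i \<inter> A)) euclidean (h i)"
    and k: "\<And>i. continuous_map (subtopology X (U i \<inter> A)) euclidean (k i)"
  shows "is_trivialization X U g A \<phi>"
proof -
  have kh: "k i p ** h i p = mat 1" if "p \<in> U i \<inter> A" for i p
    using hk [OF that] matrix_left_right_inverse by blast
  let ?Z = "prod_topology (subtopology X A) (euclidean :: (real^'n) topology)"
  have hom: "homeomorphic_map (prod_topology (subtopology X (U i \<inter> A)) euclidean)
      (subtopology ?Z ((U i \<inter> A) \<times> UNIV)) (\<lambda>x. (\<phi> \<circ> glue_point U g) (i, x))" for i
  proof -
    have top: "subtopology ?Z ((U i \<inter> A) \<times> UNIV) = prod_topology (subtopology X (U i \<inter> A)) euclidean"
      by (simp add: prod_topology_subtopology subtopology_subtopology Times_Int_Times Int_ac flip: subtopology_UNIV)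
    let ?W = "prod_topology (subtopology X (U i \<inter> A)) (euclidean :: (real^'n) topology)"
    have c: "continuous_map ?W ?W (\<lambda>z. (fst z, m (fst z) *v snd z))"
      if "continuous_map (subtopology X (U i \<inter> A)) euclidean m" for m :: "'b \<Rightarrow> real^'n^'n"
    proof -
      have "continuous_map ?W euclidean (\<lambda>z. m (fst z) *v snd z)"
        using continuous_map_compose [OF continuous_map_fst that]
        by (intro continuous_map_matrix_vector_mult) (auto simp: o_def continuous_map_snd)
      then show ?thesis
        by (simp add: continuous_map_pairwise o_def continuous_map_fst)
    qed
    have "homeomorphic_maps ?W ?W (\<lambda>z. (fst z, h i (fst z) *v snd z)) (\<lambda>z. (fst z, k i (fst z) *v snd z))"
      using c [OF h] c [OF k] by (auto simp: homeomorphic_maps_def matrix_vector_mul_assoc hk kh)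
    then have "homeomorphic_map ?W ?W (\<lambda>z. (fst z, h i (fst z) *v snd z))"
      by (rule homeomorphic_maps_imp_map)
    then show ?thesis
      unfolding top by (rule homeomorphic_map_eq) (auto simp: \<phi>)
  qed
  have inj: "inj_on \<phi> (topspace (restricted_bundle X U g A))"
  proof (rule inj_onI)
    fix c c' assume "c \<in> topspace (restricted_bundle X U g A)" "c' \<in> topspace (restricted_bundle X U g A)"
      and eq: "\<phi> c = \<phi> c'"
    then obtain i p v j p' w where c: "c = glue_point U g (i, p, v)" "p \<in> U i \<inter> A"
      and c': "c' = glue_point U g (j, p', w)" "p' \<in> U j \<inter> A"
      by (auto simp: topspace_restricted_bundle)
    with eq have "p = p'"
      by (simp add: \<phi>)
    then have c'': "c' = glue_point U g (i, p, g i j p *v w)"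
      using c c' by (simp add: glue_point_eq_iff transition_apply transition_refl)
    with eq c c'' have "h i p *v v = h i p *v (g i j p *v w)"
      by (simp add: \<phi>)
    then have "(k i p ** h i p) *v v = (k i p ** h i p) *v (g i j p *v w)"
      by (metis matrix_vector_mul_assoc)
    with kh [OF c(2)] show "c = c'"
      using c'' c by simp
  qed
  have op: "openin ?Z ((U i \<inter> A) \<times> UNIV)" for i
    using A U by (simp add: openin_prod_Times_iff Int_commute [of _ A] openin_subtopology_Int2)
  have "quotient_map (sum_topology (\<lambda>i. prod_topology (subtopology X (U i \<inter> A)) euclidean) UNIV)
      ?Z (\<phi> \<circ> glue_point U g)"
    using A op by (intro quotient_map_sum_topology_pieces [where Y = "\<lambda>i. (U i \<inter> A) \<times> UNIV"] hom) auto
  from homeomorphic_map_from_quotient [OF quotient_map_restricted_bundle [OF A(1)] this inj]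
  show ?thesis
    unfolding is_trivialization_def
    by (auto simp: topspace_restricted_bundle \<phi> glue_proj_point)
qed

end

section \<open>Bundles over spheres clutched by left multiplication\<close>

text \<open>The clutching map \<open>cl\<close> is left multiplication, read in coordinates through a linear isometry \<open>h\<close> of the
  coordinate space with the algebra. The bundle that it clutches is mapped to pairs of algebra elements,
  each fibre isometrically onto the corresponding fibre of the Hopf map.\<close>

locale hopf_clutching = euclidean_composition_algebra mul one
  for mul :: "'k::euclidean_space \<Rightarrow> 'k \<Rightarrow> 'k" (infixl \<open>\<odot>\<close> 70) and one +
  fixes h :: "real^'n \<Rightarrow> 'k" and cl :: "real^'n \<Rightarrow> real^'n^'n"
  assumes linear_h: "linear h" and bij_h: "bij h" and norm_h [simp]: "norm (h x) = norm x"
    and h_clutch: "h (cl x *v w) = h x \<odot> h w"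
begin

definition lift_base :: "(real^'n) \<times> real \<Rightarrow> 'k \<times> real" where
  "lift_base p = (h (fst p), snd p)"

definition drop_base :: "'k \<times> real \<Rightarrow> (real^'n) \<times> real" where
  "drop_base p = (inv h (fst p), snd p)"

lemma h_inv [simp]: "h (inv h y) = y" and inv_h [simp]: "inv h (h x) = x"
  using bij_h by (simp_all add: bij_is_surj surj_f_inv_f bij_is_inj)

lemma linear_inv_h: "linear (inv h)"
proof (rule linearI)
  fix x y and r :: real
  have "h (inv h x + inv h y) = x + y" "h (r *\<^sub>R inv h x) = r *\<^sub>R x"
    by (simp_all add: linear_add [OF linear_h] linear_scale [OF linear_h])
  then show "inv h (x + y) = inv h x + inv h y" "inv h (r *\<^sub>R x) = r *\<^sub>R inv h x"
    by (metis inv_h)+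
qed

lemma h_eq_0 [simp]: "h x = 0 \<longleftrightarrow> x = 0"
  by (metis norm_eq_zero norm_h)

lemma drop_lift [simp]: "drop_base (lift_base p) = p" and lift_drop [simp]: "lift_base (drop_base P) = P"
  by (simp_all add: lift_base_def drop_base_def)

lemma lift_base_mem [simp]: "lift_base p \<in> half_sphere s \<longleftrightarrow> p \<in> hemisphere s"
  by (cases p) (simp add: lift_base_def half_sphere_def hemisphere_def norm_Pair)

lemma norm_lift_base [simp]: "norm (lift_base p) = norm p"
  by (cases p) (simp add: lift_base_def norm_Pair)

lemma norm_drop_base [simp]: "norm (drop_base p) = norm p"
  by (metis lift_drop norm_lift_base)

lemma continuous_on_lift_base: "continuous_on S lift_base"
  unfolding lift_base_def [abs_def]
  by (intro continuous_intros linear_continuous_on_compose [OF _ linear_h])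

lemma continuous_on_drop_base: "continuous_on S drop_base"
  unfolding drop_base_def [abs_def]
  by (intro continuous_intros linear_continuous_on_compose [OF _ linear_inv_h])

lemma homeomorphic_map_lift_base:
  "homeomorphic_map (top_of_set (sphere 0 1)) (top_of_set (sphere 0 1)) lift_base"
proof -
  have "homeomorphic_maps (top_of_set (sphere 0 1)) (top_of_set (sphere 0 1)) lift_base drop_base"
    by (auto simp: homeomorphic_maps_def continuous_on_lift_base continuous_on_drop_base)
  then show ?thesis
    by (rule homeomorphic_maps_imp_map)
qed

lemma sphere_eq_hemispheres: "sphere 0 1 = (\<Union>s. hemisphere s :: ((real^'n) \<times> real) set)"
  by (auto simp: hemisphere_def UNIV_bool)

lemma hemisphere_subset: "hemisphere s \<subseteq> (sphere 0 1 :: ((real^'n) \<times> real) set)"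
  by (auto simp: hemisphere_def)

lemma subtopology_hemisphere:
  "subtopology (top_of_set (sphere 0 1)) (hemisphere s) = top_of_set (hemisphere s :: ((real^'n) \<times> real) set)"
  by (simp add: subtopology_subtopology sphere_eq_hemispheres Int_absorb1 UN_upper)

lemma closed_hemisphere: "closed (hemisphere s :: ((real^'n) \<times> real) set)"
proof -
  have "(hemisphere s :: ((real^'n) \<times> real) set) = sphere 0 1 \<inter> (if s then {p. 0 \<le> snd p} else {p. snd p \<le> 0})"
    by (auto simp: hemisphere_def)
  moreover have "closed {p :: (real^'n) \<times> real. 0 \<le> snd p}" "closed {p :: (real^'n) \<times> real. snd p \<le> 0}"
    by (intro closed_Collect_le continuous_intros)+
  ultimately show ?thesis
    using closed_sphere [of "0 :: (real^'n) \<times> real" 1] by (cases s) (simp_all add: closed_Int)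
qed

lemma clutch_invertible:
  assumes "norm x = 1"
  shows "cl x ** matrix_inv (cl x) = mat 1" "matrix_inv (cl x) ** cl x = mat 1"
proof -
  have "cl x *v w = 0 \<Longrightarrow> w = 0" for w
    using norm_mul [of "h x" "h w"] h_clutch [of x w] assms
    by (simp add: linear_0 [OF linear_h])
  then have "invertible (cl x)"
    by (simp add: invertible_left_inverse matrix_left_invertible_ker)
  then show "cl x ** matrix_inv (cl x) = mat 1" "matrix_inv (cl x) ** cl x = mat 1"
    using someI_ex [of "\<lambda>B. cl x ** B = mat 1 \<and> B ** cl x = mat 1"]
    unfolding invertible_def matrix_inv_def by blast+
qed

lemma equator: "\<lbrakk>p \<in> hemisphere True; p \<in> hemisphere False\<rbrakk> \<Longrightarrow> snd p = 0 \<and> norm (fst p) = 1"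
  using norm_ge_zero [of "fst p"]
  by (cases p) (auto simp: hemisphere_def norm_Pair power2_eq_1_iff simp del: norm_ge_zero)

sublocale bundle_gluing "top_of_set (sphere 0 1)" hemisphere "clutch_transition cl"
proof
  fix i j k and p :: "(real^'n) \<times> real"
  show "hemisphere i \<subseteq> topspace (top_of_set (sphere 0 1 :: ((real^'n) \<times> real) set))"
    by (simp add: hemisphere_subset)
  show "clutch_transition cl i i p = mat 1"
    by (simp add: clutch_transition_def)
  assume "p \<in> hemisphere i" "p \<in> hemisphere j" "p \<in> hemisphere k"
  then show "clutch_transition cl i j p ** clutch_transition cl j k p = clutch_transition cl i k p"
    using equator [of p] clutch_invertible [of "fst p"]
    by (cases i; cases j; cases k) (auto simp: clutch_transition_def)
qed

text \<open>The choice of a representative is harmless: triples that are identified have the same image, by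
  the lemma that follows.\<close>

definition frame_map :: "(bool \<times> ((real^'n) \<times> real) \<times> (real^'n)) set \<Rightarrow> 'k \<times> 'k" where
  "frame_map c = (case SOME z. z \<in> c of (s, p, w) \<Rightarrow> hopf_frame s (lift_base p) (h w))"

lemma hopf_frame_transition:
  assumes "p \<in> hemisphere s" "p \<in> hemisphere s'"
  shows "hopf_frame s (lift_base p) (h (clutch_transition cl s s' p *v w)) = hopf_frame s' (lift_base p) (h w)"
proof -
  have main: "hopf_frame True (lift_base p) (h (cl (fst p) *v v)) = hopf_frame False (lift_base p) (h v)"
    if "p \<in> hemisphere True" "p \<in> hemisphere False" for v
    using equator [OF that] by (simp add: lift_base_def h_clutch hopf_frame_equator)
  show ?thesis
    using assms main [of w] main [of "matrix_inv (cl (fst p)) *v w"] equator [of p] clutch_invertible [of "fst p"]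
    by (cases s; cases s') (auto simp: clutch_transition_def matrix_vector_mul_assoc)
qed

lemma frame_map_point:
  assumes "p \<in> hemisphere s"
  shows "frame_map (clutch_point cl (s, p, w)) = hopf_frame s (lift_base p) (h w)"
proof -
  let ?c = "clutch_point cl (s, p, w)"
  have mem: "(s', p', w') \<in> ?c \<longleftrightarrow> p = p' \<and> p \<in> hemisphere s \<inter> hemisphere s' \<and> w = clutch_transition cl s s' p *v w'"
    for s' p' w'
    by (simp add: clutch_point_def mem_glue_point)
  obtain s' p' w' where z: "(SOME z. z \<in> ?c) = (s', p', w')"
    by (cases "SOME z. z \<in> ?c")
  have "(s, p, w) \<in> ?c"
    using assms by (simp add: mem transition_refl)
  then have "(SOME z. z \<in> ?c) \<in> ?c"
    by (rule someI)
  moreover have "frame_map ?c = hopf_frame s' (lift_base p') (h w')"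
    unfolding frame_map_def z by simp
  ultimately have "frame_map ?c = hopf_frame s' (lift_base p) (h w')"
    "p \<in> hemisphere s'" "w = clutch_transition cl s s' p *v w'"
    unfolding z mem by auto
  then show ?thesis
    using assms by (simp add: hopf_frame_transition)
qed

text \<open>Stated for an arbitrary \<open>G\<close>, since it is applied to the frames and to their inverses, the coordinates.\<close>

lemma continuous_map_over_hemisphere:
  fixes v :: "'x \<Rightarrow> 'v::real_normed_vector"
  assumes G: "continuous_on (half_sphere s \<times> UNIV) (\<lambda>z. G (fst z) (snd z))"
    and f: "continuous_map X (top_of_set (hemisphere s)) f" and v: "continuous_map X euclidean v"
  shows "continuous_map X euclidean (\<lambda>x. G (lift_base (f x)) (v x))"
proof -
  have "continuous_map X (top_of_set (hemisphere s \<times> UNIV)) (\<lambda>x. (f x, v x))"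
    using f v by (simp add: continuous_map_pairwise o_def flip: prod_topology_subtopology_eu)
  moreover have "continuous_map (top_of_set (hemisphere s \<times> UNIV)) (top_of_set (half_sphere s \<times> UNIV))
     (\<lambda>z :: ((real^'n) \<times> real) \<times> 'v. (lift_base (fst z), snd z))"
    by (auto intro!: continuous_intros continuous_on_compose2 [OF continuous_on_lift_base])
  ultimately have "continuous_map X (top_of_set (half_sphere s \<times> UNIV))
      ((\<lambda>z. (lift_base (fst z), snd z)) \<circ> (\<lambda>x. (f x, v x)))"
    by (rule continuous_map_compose)
  then have "continuous_map X (top_of_set (half_sphere s \<times> UNIV)) (\<lambda>x. (lift_base (f x), v x))"
    by (simp add: o_def)
  from continuous_map_compose [OF this, of euclidean "\<lambda>z. G (fst z) (snd z)"]
  show ?thesis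
    using G by (simp add: o_def)
qed

lemmas continuous_map_frame_piece = continuous_map_over_hemisphere [OF continuous_on_hopf_frame]

lemmas continuous_map_coord_piece =
  continuous_map_over_hemisphere [where G = "\<lambda>P z. inv h (hopf_coord s P z)" for s,
    OF linear_continuous_on_compose [OF continuous_on_hopf_coord linear_inv_h]]

lemma continuous_map_h: "continuous_map X euclidean f \<Longrightarrow> continuous_map X euclidean (\<lambda>x. h (f x))"
  using continuous_map_compose [of X euclidean f euclidean h] linear_continuous_on [of h UNIV] linear_h
  by (simp add: o_def linear_conv_bounded_linear)

lemma continuous_map_frame_map: "continuous_map (clutched_bundle cl) euclidean frame_map"
proof -
  let ?W = "\<lambda>s. prod_topology (subtopology (top_of_set (sphere 0 1)) (hemisphere s)) (euclidean :: (real^'n) topology)"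
  have "continuous_map (sum_topology ?W UNIV) euclidean (frame_map \<circ> glue_point hemisphere (clutch_transition cl))"
  proof (rule continuous_map_sum_topology)
    fix s
    have "continuous_map (?W s) euclidean (\<lambda>x. hopf_frame s (lift_base (fst x)) (h (snd x)))"
      unfolding subtopology_hemisphere
      by (intro continuous_map_frame_piece continuous_map_h continuous_map_fst continuous_map_snd)
    then show "continuous_map (?W s) euclidean (\<lambda>x. (frame_map \<circ> glue_point hemisphere (clutch_transition cl)) (s, x))"
      by (rule continuous_map_eq) (use frame_map_point in \<open>auto simp: clutch_point_def\<close>)
  qed
  then show ?thesis
    unfolding clutched_bundle_def by (rule continuous_compose_quotient_map [OF quotient_map_glued_bundle])
qed

text \<open>Together with \<open>hopf_map_frame_map\<close>, which recovers the base point of a nonzero vector from its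
  image, this is the injectivity of the map on vectors of norm one.\<close>

lemma clutch_point_eqI:
  assumes p: "p \<in> hemisphere s" "p \<in> hemisphere s'"
    and eq: "frame_map (clutch_point cl (s, p, w)) = frame_map (clutch_point cl (s', p, w'))"
  shows "clutch_point cl (s, p, w) = clutch_point cl (s', p, w')"
proof -
  have "hopf_frame s (lift_base p) (h w) = hopf_frame s (lift_base p) (h (clutch_transition cl s s' p *v w'))"
    using eq p by (simp add: frame_map_point hopf_frame_transition)
  then have "h w = h (clutch_transition cl s s' p *v w')"
    using p by (metis hopf_coord_frame lift_base_mem)
  then have "w = clutch_transition cl s s' p *v w'"
    by (metis inv_h)
  then show ?thesis
    using p by (simp add: clutch_point_def glue_point_eq_iff)
qed

lemma topspace_clutched_bundle: "topspace (clutched_bundle cl) = {clutch_point cl (s, p, w) | s p w. p \<in> hemisphere s}"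
  by (simp add: clutched_bundle_def clutch_point_def topspace_glued_bundle)

lemma hopf_map_frame_map:
  "p \<in> hemisphere s \<Longrightarrow> hopf_map (frame_map (clutch_point cl (s, p, w))) = (norm w)\<^sup>2 *\<^sub>R lift_base p"
  by (simp add: frame_map_point hopf_map_frame)

lemma linear_frame_fibre: "linear (\<lambda>w. hopf_frame s P (h w))"
  using linear_compose [OF linear_h linear_hopf_frame] by (simp add: o_def)

lemma topspace_unit_sphere_bundle:
  "topspace (unit_sphere_bundle cl) = {clutch_point cl (s, p, w) | s p w. p \<in> hemisphere s \<and> norm w = 1}"
  by (auto simp: unit_sphere_bundle_def topspace_clutched_bundle)

text \<open>The sphere bundle is the image of two compact products, one over each hemisphere.\<close>

lemma compact_space_unit_sphere_bundle: "compact_space (unit_sphere_bundle cl)"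
proof -
  let ?W = "\<lambda>s. prod_topology (subtopology (top_of_set (sphere 0 1)) (hemisphere s)) (euclidean :: (real^'n) topology)"
  have "compactin (clutched_bundle cl) ((\<lambda>x. clutch_point cl (s, x)) ` (hemisphere s \<times> sphere 0 1))" for s
  proof (rule image_compactin)
    have "compact (hemisphere s :: ((real^'n) \<times> real) set)"
      using compact_Int_closed [OF compact_sphere closed_hemisphere, of 0 1 s]
      by (simp add: sphere_eq_hemispheres Int_absorb1 UN_upper)
    then show "compactin (?W s) ((hemisphere s :: ((real^'n) \<times> real) set) \<times> sphere 0 1)"
      unfolding subtopology_hemisphere by (simp add: compactin_Times compactin_subtopology hemisphere_subset)
    have "continuous_map (?W s) (clutched_bundle cl) (glue_point hemisphere (clutch_transition cl) \<circ> (\<lambda>x. (s, x)))"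
      unfolding clutched_bundle_def
      by (rule continuous_map_compose [OF continuous_map_component_injection [OF UNIV_I]
          quotient_imp_continuous_map [OF quotient_map_glued_bundle]])
    then show "continuous_map (?W s) (clutched_bundle cl) (\<lambda>x. clutch_point cl (s, x))"
      by (simp add: clutch_point_def o_def)
  qed
  then have "compactin (clutched_bundle cl) (\<Union>s. (\<lambda>x. clutch_point cl (s, x)) ` (hemisphere s \<times> sphere 0 1))"
    by (intro compactin_Union) auto
  moreover have "(\<Union>s. (\<lambda>x. clutch_point cl (s, x)) ` (hemisphere s \<times> sphere 0 1))
      = {clutch_point cl (s, p, w) | s p w. p \<in> hemisphere s \<and> norm w = 1}"
    by force
  ultimately show ?thesis
    unfolding unit_sphere_bundle_def by (simp add: compact_space_subtopology)
qed

lemma frame_map_onto_sphere: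
  assumes "z \<in> sphere 0 1"
  obtains s p w where "p \<in> hemisphere s" "norm w = 1" "frame_map (clutch_point cl (s, p, w)) = z"
proof -
  define p where "p = drop_base (hopf_map z)"
  have "p \<in> sphere 0 1"
    using hopf_map_in_sphere [OF assms] by (simp add: p_def)
  then obtain s where s: "p \<in> hemisphere s"
    using sphere_eq_hemispheres by blast
  then have s': "hopf_map z \<in> half_sphere s"
    by (metis lift_base_mem lift_drop p_def)
  define w where "w = inv h (hopf_coord s (hopf_map z) z)"
  have z: "frame_map (clutch_point cl (s, p, w)) = z"
    using s s' assms by (simp add: frame_map_point p_def w_def hopf_frame_coord)
  moreover have "norm w = 1"
    using z norm_hopf_frame [of "lift_base p" s "h w"] s assms by (simp add: frame_map_point)
  ultimately show ?thesis
    using that s by blast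
qed

lemma homeomorphic_map_unit_sphere_bundle:
  "homeomorphic_map (unit_sphere_bundle cl) (top_of_set (sphere 0 1)) frame_map"
proof (rule continuous_imp_homeomorphic_map)
  show "compact_space (unit_sphere_bundle cl)"
    by (rule compact_space_unit_sphere_bundle)
  show "Hausdorff_space (top_of_set (sphere (0 :: 'k \<times> 'k) 1))"
    by (simp add: Hausdorff_space_subtopology)
  show im: "frame_map ` topspace (unit_sphere_bundle cl) = topspace (top_of_set (sphere 0 1))"
  proof (intro equalityI subsetI)
    fix z assume "z \<in> frame_map ` topspace (unit_sphere_bundle cl)"
    then show "z \<in> topspace (top_of_set (sphere 0 1))"
      by (auto simp: topspace_unit_sphere_bundle frame_map_point norm_hopf_frame)
  next
    fix z assume "z \<in> topspace (top_of_set (sphere (0 :: 'k \<times> 'k) 1))"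
    then have "z \<in> sphere 0 1"
      by simp
    then obtain s p w where "p \<in> hemisphere s" "norm w = 1" "frame_map (clutch_point cl (s, p, w)) = z"
      by (rule frame_map_onto_sphere)
    then show "z \<in> frame_map ` topspace (unit_sphere_bundle cl)"
      unfolding topspace_unit_sphere_bundle by blast
  qed
  then show "continuous_map (unit_sphere_bundle cl) (top_of_set (sphere 0 1)) frame_map"
    using continuous_map_from_subtopology [OF continuous_map_frame_map]
    by (simp add: continuous_map_in_subtopology unit_sphere_bundle_def image_subset_iff_funcset [symmetric])
  show "inj_on frame_map (topspace (unit_sphere_bundle cl))"
  proof (rule inj_onI)
    fix c c' assume "c \<in> topspace (unit_sphere_bundle cl)" "c' \<in> topspace (unit_sphere_bundle cl)"
      and eq: "frame_map c = frame_map c'"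
    then obtain s p w s' p' w' where c: "c = clutch_point cl (s, p, w)" "p \<in> hemisphere s" "norm w = 1"
      and c': "c' = clutch_point cl (s', p', w')" "p' \<in> hemisphere s'" "norm w' = 1"
      by (auto simp: topspace_unit_sphere_bundle)
    have "lift_base p = lift_base p'"
      using hopf_map_frame_map [OF c(2), of w] hopf_map_frame_map [OF c'(2), of w'] eq c c' by simp
    then have "p = p'"
      by (metis drop_lift)
    with c c' eq show "c = c'"
      using clutch_point_eqI by simp
  qed
qed

end

section \<open>Tautological bundles over projective lines\<close>

text \<open>Associativity is what makes right multiplication by scalars preserve the fibres of the Hopf map, so
  that these fibres are lines and the image of the clutched bundle is the tautological bundle.\<close>

locale associative_hopf_clutching = hopf_clutching mul one h cl
  for mul :: "'k::euclidean_space \<Rightarrow> 'k \<Rightarrow> 'k" (infixl \<open>\<odot>\<close> 70) and one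
    and h :: "real^'n \<Rightarrow> 'k" and cl :: "real^'n \<Rightarrow> real^'n^'n" +
  assumes mul_assoc: "(a \<odot> b) \<odot> c = a \<odot> (b \<odot> c)"
begin

lemma right_line_scaleR:
  assumes "r \<noteq> 0"
  shows "right_line mul (r *\<^sub>R z) = right_line mul z"
proof (intro equalityI subsetI)
  fix v assume "v \<in> right_line mul (r *\<^sub>R z)"
  then obtain a where "v = ((r *\<^sub>R fst z) \<odot> a, (r *\<^sub>R snd z) \<odot> a)"
    by (auto simp: right_line_def)
  then have "v = (fst z \<odot> (r *\<^sub>R a), snd z \<odot> (r *\<^sub>R a))"
    by (simp add: mul_simps)
  then show "v \<in> right_line mul z"
    unfolding right_line_def by blast
next
  fix v assume "v \<in> right_line mul z"
  then obtain a where "v = (fst z \<odot> a, snd z \<odot> a)"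
    by (auto simp: right_line_def)
  then have "v = (fst (r *\<^sub>R z) \<odot> ((1 / r) *\<^sub>R a), snd (r *\<^sub>R z) \<odot> ((1 / r) *\<^sub>R a))"
    using assms by (simp add: mul_simps)
  then show "v \<in> right_line mul (r *\<^sub>R z)"
    unfolding right_line_def by blast
qed

text \<open>By associativity, multiplying \<open>hopf_frame s P w\<close> by \<open>a\<close> from the right gives
  \<open>hopf_frame s P (w \<odot> a)\<close>, and for \<open>w \<noteq> 0\<close> every element is of the form \<open>w \<odot> a\<close>.\<close>

lemma right_line_hopf_frame:
  assumes "w \<noteq> 0"
  shows "right_line mul (hopf_frame s P w) = range (hopf_frame s P)"
proof -
  have mul_frame: "(fst (hopf_frame s P w) \<odot> a, snd (hopf_frame s P w) \<odot> a) = hopf_frame s P (w \<odot> a)" for a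
    by (simp add: hopf_frame_def mul_simps mul_assoc)
  have "w \<odot> ((1 / (norm w)\<^sup>2) *\<^sub>R (conjugate w \<odot> v)) = v" for v
    using assms by (simp add: mul_simps mul_conj_mul)
  then have "range ((\<odot>) w) = UNIV"
    by (metis surj_def)
  then have "range (\<lambda>a. hopf_frame s P (w \<odot> a)) = range (hopf_frame s P)"
    by (metis image_image)
  then show ?thesis
    unfolding right_line_def mul_frame by (simp add: full_SetCompr_eq)
qed

text \<open>The generator \<open>(one, h x / (1 - t))\<close> of the line is a positive multiple of a value of the frame: at
  \<open>one\<close> on the lower hemisphere and at \<open>h x / (1 - t)\<close> on the upper one. The pole \<open>t = 1\<close> is treated
  separately, as the line is defined by a different generator there.\<close>

lemma stereo_line_eq_range:
  assumes "p \<in> hemisphere s"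
  shows "stereo_line mul one h p = range (hopf_frame s (lift_base p))"
proof -
  obtain x t where p: "p = (x, t)" by (cases p)
  have x: "(norm x)\<^sup>2 = (1 + t) * (1 - t)"
    using assms by (simp add: hemisphere_def p norm_Pair algebra_simps power2_eq_square split: if_splits)
  have t: "if s then t \<ge> 0 else t \<le> 0"
    using assms by (auto simp: hemisphere_def p split: if_splits)
  show ?thesis
  proof (cases "t = 1")
    case True
    with x t have "x = 0" s
      by (auto split: if_splits)
    then have "hopf_frame s (lift_base p) one = (0, one)"
      using True by (simp add: hopf_frame_def p lift_base_def linear_0 [OF linear_h] linear_0 [OF linear_conj])
    then show ?thesis
      using right_line_hopf_frame [of one s "lift_base p"] True by (simp add: stereo_line_def p)
  next
    case False
    have y: "stereo_line mul one h p = right_line mul (one, (1 / (1 - t)) *\<^sub>R h x)"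
      using False by (simp add: stereo_line_def p)
    show ?thesis
    proof (cases s)
      case True
      then have t1: "1 + t > 0" "1 - t \<noteq> 0"
        using t \<open>t \<noteq> 1\<close> by auto
      define r where "r = sqrt ((1 + t) / 2)"
      have r: "r > 0" using t1 by (simp add: r_def)
      have "x \<noteq> 0" using x t1 by auto
      then have "(1 / (1 - t)) *\<^sub>R h x \<noteq> 0"
        using t1 by simp
      moreover have "hopf_frame s (lift_base p) ((1 / (1 - t)) *\<^sub>R h x) = r *\<^sub>R (one, (1 / (1 - t)) *\<^sub>R h x)"
      proof -
        have "conjugate (h x) \<odot> h x = ((1 + t) * (1 - t)) *\<^sub>R one"
          using conj_mul_mul [of "h x" one] by (simp add: x)
        then show ?thesis
          using t1 True by (simp add: hopf_frame_def p lift_base_def mul_simps r_def)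
      qed
      ultimately show ?thesis
        using right_line_hopf_frame [of "(1 / (1 - t)) *\<^sub>R h x" s "lift_base p"]
          right_line_scaleR [of r "(one, (1 / (1 - t)) *\<^sub>R h x)"] r y by simp
    next
      case False
      define r where "r = sqrt ((1 - t) / 2)"
      have "r > 0" using t False by (simp add: r_def)
      moreover have "hopf_frame s (lift_base p) one = r *\<^sub>R (one, (1 / (1 - t)) *\<^sub>R h x)"
        using False by (simp add: hopf_frame_def p lift_base_def r_def)
      ultimately show ?thesis
        using right_line_hopf_frame [of one s "lift_base p"]
          right_line_scaleR [of r "(one, (1 / (1 - t)) *\<^sub>R h x)"] y by simp
    qed
  qed
qed

text \<open>The base point of a nonzero vector; it depends only on the line through the vector and is the
  inverse of the stereographic identification of the sphere with the projective line.\<close>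

definition hopf_point :: "'k \<times> 'k \<Rightarrow> (real^'n) \<times> real" where
  "hopf_point z = drop_base (hopf_map ((1 / norm z) *\<^sub>R z))"

lemma hopf_point_in_sphere: "z \<noteq> 0 \<Longrightarrow> hopf_point z \<in> sphere 0 1"
  using hopf_map_in_sphere [of "(1 / norm z) *\<^sub>R z"] by (simp add: hopf_point_def)

lemma stereo_line_hopf_point:
  assumes "z \<noteq> 0"
  shows "stereo_line mul one h (hopf_point z) = right_line mul z"
proof -
  define z' where "z' = (1 / norm z) *\<^sub>R z"
  have z': "z' \<in> sphere 0 1" using assms by (simp add: z'_def)
  obtain s where s: "hopf_point z \<in> hemisphere s"
    using hopf_point_in_sphere [OF assms] sphere_eq_hemispheres by blast
  have L: "lift_base (hopf_point z) = hopf_map z'"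
    by (simp add: hopf_point_def z'_def)
  then have "hopf_map z' \<in> half_sphere s"
    using s by (metis lift_base_mem)
  then have w: "hopf_frame s (hopf_map z') (hopf_coord s (hopf_map z') z') = z'"
    using z' hopf_frame_coord by blast
  then have "hopf_coord s (hopf_map z') z' \<noteq> 0"
    using z' linear_0 [OF linear_hopf_frame, of s "hopf_map z'"] by (intro notI) simp
  from right_line_hopf_frame [OF this, of s "hopf_map z'"]
  have "right_line mul z' = range (hopf_frame s (hopf_map z'))"
    unfolding w .
  also have "\<dots> = stereo_line mul one h (hopf_point z)"
    using s L stereo_line_eq_range by simp
  finally show ?thesis
    using right_line_scaleR [of "1 / norm z" z] assms by (simp add: z'_def)
qed

lemma hopf_point_of_mem:
  assumes p: "p \<in> sphere 0 1" and v: "v \<in> stereo_line mul one h p" "v \<noteq> 0"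
  shows "hopf_point v = p"
proof -
  obtain s where s: "p \<in> hemisphere s"
    using p sphere_eq_hemispheres by blast
  then obtain w where w: "v = hopf_frame s (lift_base p) w"
    using v stereo_line_eq_range by blast
  have "(1 / norm v) *\<^sub>R v = hopf_frame s (lift_base p) ((1 / norm v) *\<^sub>R w)"
    by (simp add: w linear_scale [OF linear_hopf_frame])
  moreover have "norm v = norm w"
    using s w norm_hopf_frame by simp
  moreover have "w \<noteq> 0"
    using calculation(2) v by auto
  ultimately show ?thesis
    using s v by (simp add: hopf_point_def hopf_map_frame del: scaleR_Pair)
qed

lemma hopf_frame_one_nonzero: "p \<in> hemisphere s \<Longrightarrow> hopf_frame s (lift_base p) one \<noteq> 0"
  using norm_hopf_frame [of "lift_base p" s one] by auto

lemma stereo_line_nonzero: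
  assumes "p \<in> sphere 0 1"
  obtains v where "v \<in> stereo_line mul one h p" "v \<noteq> 0"
proof -
  obtain s where s: "p \<in> hemisphere s"
    using assms sphere_eq_hemispheres by blast
  then show ?thesis
    using that [of "hopf_frame s (lift_base p) one"] stereo_line_eq_range [OF s] hopf_frame_one_nonzero [OF s]
    by simp
qed

lemma inj_on_stereo_line: "inj_on (stereo_line mul one h) (sphere 0 1)"
proof (rule inj_onI)
  fix p q assume "p \<in> sphere 0 1" "q \<in> sphere 0 1" "stereo_line mul one h p = stereo_line mul one h q"
  then show "p = q"
    using stereo_line_nonzero [of p] hopf_point_of_mem [of p] hopf_point_of_mem [of q] by metis
qed

lemma quotient_map_right_line: "quotient_map (top_of_set (- {0})) (proj_line mul) (right_line mul)"
  by (simp add: proj_line_def quotient_map_quotient_topology)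

lemma continuous_map_stereo_line:
  "continuous_map (top_of_set (sphere 0 1)) (proj_line mul) (stereo_line mul one h)"
proof (rule pasting_lemma_closed [where I = UNIV and T = hemisphere and f = "\<lambda>s. stereo_line mul one h"])
  fix s
  show "closedin (top_of_set (sphere 0 1)) (hemisphere s :: ((real^'n) \<times> real) set)"
    using closed_hemisphere hemisphere_subset closed_subset by blast
  let ?H = "top_of_set (hemisphere s :: ((real^'n) \<times> real) set)"
  have "continuous_map ?H euclidean (\<lambda>p. hopf_frame s (lift_base p) one)"
    by (rule continuous_map_frame_piece) auto
  then have "continuous_map ?H (top_of_set (- {0})) (\<lambda>p. hopf_frame s (lift_base p) one)"
    using hopf_frame_one_nonzero by (simp add: continuous_map_in_subtopology Pi_iff)
  from continuous_map_compose [OF this quotient_imp_continuous_map [OF quotient_map_right_line]]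
  have "continuous_map ?H (proj_line mul) (\<lambda>p. right_line mul (hopf_frame s (lift_base p) one))"
    by (simp add: o_def)
  then show "continuous_map (subtopology (top_of_set (sphere 0 1)) (hemisphere s)) (proj_line mul) (stereo_line mul one h)"
    unfolding subtopology_hemisphere
    by (rule continuous_map_eq) (use norm_one in \<open>auto simp: stereo_line_eq_range intro!: right_line_hopf_frame\<close>)
qed (use sphere_eq_hemispheres in auto)

text \<open>Composed with \<open>hopf_point\<close>, the stereographic identification is the quotient map that defines the
  projective line. Hence it is a quotient map as well, and it is injective.\<close>

lemma homeomorphic_map_stereo_line:
  "homeomorphic_map (top_of_set (sphere 0 1)) (proj_line mul) (stereo_line mul one h)"
proof -
  have "continuous_on (- {0}) hopf_point"
    unfolding hopf_point_def
    by (intro continuous_on_compose2 [OF continuous_on_drop_base]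
        continuous_on_compose2 [OF continuous_on_hopf_map] continuous_intros) auto
  then have c: "continuous_map (top_of_set (- {0})) (top_of_set (sphere 0 1)) hopf_point"
    using hopf_point_in_sphere by auto
  have "quotient_map (top_of_set (- {0})) (proj_line mul) (stereo_line mul one h \<circ> hopf_point)"
    by (rule quotient_map_eq [OF quotient_map_right_line]) (simp add: stereo_line_hopf_point)
  from quotient_map_from_composition [OF c continuous_map_stereo_line this] inj_on_stereo_line
  show ?thesis
    by (simp add: homeomorphic_map_def)
qed

text \<open>Over each closed hemisphere the frame has a continuous inverse, given by the base point of the line
  and the coordinate of the vector, so the two pieces are embedded as closed subsets that cover the
  tautological bundle.\<close>

lemma homeomorphic_map_tautological:
  "homeomorphic_map (clutched_bundle cl) (tautological_bundle mul)
     (\<lambda>c. (stereo_line mul one h (glue_proj c), frame_map c))"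
proof -
  let ?st = "stereo_line mul one h"
  let ?F = "\<lambda>c. (?st (glue_proj c), frame_map c)"
  obtain st' where st': "homeomorphic_maps (top_of_set (sphere 0 1)) (proj_line mul) ?st st'"
    using homeomorphic_map_stereo_line homeomorphic_map_maps by blast
  then have c': "continuous_map (proj_line mul) (top_of_set (sphere 0 1)) st'"
    and inv1: "\<And>p. p \<in> sphere 0 1 \<Longrightarrow> st' (?st p) = p"
    and inv2: "\<And>l. l \<in> topspace (proj_line mul) \<Longrightarrow> ?st (st' l) = l"
    by (auto simp: homeomorphic_maps_def)
  have st'_sphere: "st' l \<in> sphere 0 1" if "l \<in> topspace (proj_line mul)" for l
    using c' that continuous_map_image_subset_topspace by fastforce
  have st_top: "?st p \<in> topspace (proj_line mul)" if "p \<in> sphere 0 1" for p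
    using continuous_map_image_subset_topspace [OF continuous_map_stereo_line] that by auto
  have top: "topspace (tautological_bundle mul) = {(l, v). l \<in> topspace (proj_line mul) \<and> v \<in> l}"
    by (auto simp: tautological_bundle_def)
  let ?Y = "\<lambda>s. {z \<in> topspace (tautological_bundle mul). st' (fst z) \<in> hemisphere s}"
  let ?W = "\<lambda>s. prod_topology (subtopology (top_of_set (sphere (0 :: (real^'n) \<times> real) 1)) (hemisphere s)) (euclidean :: (real^'n) topology)"
  have fst: "continuous_map (tautological_bundle mul) (proj_line mul) fst"
    and snd: "continuous_map (tautological_bundle mul) euclidean snd"
    unfolding tautological_bundle_def by (intro continuous_intros)+
  have st'_fst: "continuous_map (tautological_bundle mul) (top_of_set (sphere 0 1)) (\<lambda>z. st' (fst z))"
    using continuous_map_compose [OF fst c'] by (simp add: o_def)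
  have hom: "homeomorphic_map (?W s) (subtopology (tautological_bundle mul) (?Y s))
      (\<lambda>x. (?F \<circ> glue_point hemisphere (clutch_transition cl)) (s, x))" for s
  proof -
    let ?f = "\<lambda>x. (?st (fst x), hopf_frame s (lift_base (fst x)) (h (snd x)))"
    let ?g = "\<lambda>z. (st' (fst z), inv h (hopf_coord s (lift_base (st' (fst z))) (snd z)))"
    have cf: "continuous_map (?W s) (subtopology (tautological_bundle mul) (?Y s)) ?f"
    proof -
      have 1: "continuous_map (?W s) euclidean (\<lambda>x. hopf_frame s (lift_base (fst x)) (h (snd x)))"
        unfolding subtopology_hemisphere
        by (intro continuous_map_frame_piece continuous_map_h continuous_map_fst continuous_map_snd)
      have 2: "continuous_map (?W s) (proj_line mul) (\<lambda>x. ?st (fst x))"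
        using continuous_map_compose [OF continuous_map_fst continuous_map_from_subtopology [OF continuous_map_stereo_line]]
        by (simp add: o_def)
      have "continuous_map (?W s) (prod_topology (proj_line mul) euclidean) ?f"
        using 1 2 by (simp add: continuous_map_pairwise o_def)
      moreover have "?f x \<in> ?Y s" if x: "x \<in> topspace (?W s)" for x
      proof -
        have "fst x \<in> hemisphere s" "fst x \<in> sphere 0 1"
          using x by auto
        moreover from this have "hopf_frame s (lift_base (fst x)) (h (snd x)) \<in> ?st (fst x)"
          by (simp add: stereo_line_eq_range)
        ultimately show ?thesis
          using st_top [of "fst x"] by (simp add: top inv1)
      qed
      ultimately show ?thesis
        by (auto simp: tautological_bundle_def continuous_map_in_subtopology)
    qed
    have cg: "continuous_map (subtopology (tautological_bundle mul) (?Y s)) (?W s) ?g"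
    proof -
      have 1: "continuous_map (subtopology (tautological_bundle mul) (?Y s)) (top_of_set (hemisphere s)) (\<lambda>z. st' (fst z))"
        using continuous_map_from_subtopology [OF st'_fst, of "?Y s"]
        by (auto simp: continuous_map_in_subtopology)
      then show ?thesis
        unfolding subtopology_hemisphere
        using continuous_map_coord_piece [OF 1 continuous_map_from_subtopology [OF snd]]
        by (simp add: continuous_map_pairwise o_def)
    qed
    have "homeomorphic_maps (?W s) (subtopology (tautological_bundle mul) (?Y s)) ?f ?g"
      unfolding homeomorphic_maps_def
    proof (intro conjI ballI cf cg)
      fix x assume "x \<in> topspace (?W s)"
      then have "fst x \<in> hemisphere s" "fst x \<in> sphere 0 1"
        by auto
      then show "?g (?f x) = x"
        by (simp add: inv1 hopf_coord_frame)
    next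
      fix z assume z: "z \<in> topspace (subtopology (tautological_bundle mul) (?Y s))"
      then have l: "fst z \<in> topspace (proj_line mul)" "snd z \<in> fst z" "st' (fst z) \<in> hemisphere s"
        by (auto simp: top)
      have "snd z \<in> range (hopf_frame s (lift_base (st' (fst z))))"
        using l by (metis inv2 stereo_line_eq_range)
      then obtain w where "snd z = hopf_frame s (lift_base (st' (fst z))) w"
        by blast
      then show "?f (?g z) = z"
        using l by (cases z) (simp add: inv2 hopf_coord_frame)
    qed
    then have "homeomorphic_map (?W s) (subtopology (tautological_bundle mul) (?Y s)) ?f"
      by (rule homeomorphic_maps_imp_map)
    then show ?thesis
      by (rule homeomorphic_map_eq)
         (use frame_map_point in \<open>auto simp: glue_proj_point clutch_point_def\<close>)
  qed
  have "quotient_map (sum_topology ?W UNIV) (tautological_bundle mul) (?F \<circ> glue_point hemisphere (clutch_transition cl))"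
  proof (rule quotient_map_sum_topology_pieces [where Y = ?Y])
    show "topspace (tautological_bundle mul) \<subseteq> (\<Union>s. ?Y s)"
      using st'_sphere sphere_eq_hemispheres by (auto simp: top)
    have "closedin (tautological_bundle mul) (?Y s)" for s
    proof -
      have "closedin (top_of_set (sphere 0 1)) (hemisphere s :: ((real^'n) \<times> real) set)"
        using closed_hemisphere hemisphere_subset closed_subset by blast
      then show ?thesis
        by (rule closedin_continuous_map_preimage [OF st'_fst])
    qed
    then show "(\<forall>s\<in>UNIV. openin (tautological_bundle mul) (?Y s)) \<or>
        finite (UNIV :: bool set) \<and> (\<forall>s\<in>UNIV. closedin (tautological_bundle mul) (?Y s))"
      by simp
  qed (rule hom)
  moreover have "inj_on ?F (topspace (clutched_bundle cl))"
  proof (rule inj_onI)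
    fix c c' assume "c \<in> topspace (clutched_bundle cl)" "c' \<in> topspace (clutched_bundle cl)"
      and eq: "?F c = ?F c'"
    then obtain s p w s' p' w' where c: "c = clutch_point cl (s, p, w)" "p \<in> hemisphere s"
      and c': "c' = clutch_point cl (s', p', w')" "p' \<in> hemisphere s'"
      by (auto simp: topspace_clutched_bundle)
    have "p \<in> sphere 0 1" "p' \<in> sphere 0 1"
      using c c' hemisphere_subset by blast+
    moreover have "?st p = ?st p'"
      using eq c c' by (simp add: clutch_point_def glue_proj_point)
    ultimately have "p = p'"
      by (metis inv1)
    with c c' eq show "c = c'"
      using clutch_point_eqI by simp
  qed
  ultimately show ?thesis
    unfolding clutched_bundle_def by (rule homeomorphic_map_from_quotient [OF quotient_map_glued_bundle])
qed

theorem real_clutching_of_tautological: "real_clutching_of_tautological mul one h cl"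
  unfolding real_clutching_of_tautological_def
proof (intro conjI exI ballI allI)
  show "homeomorphic_map (top_of_set (sphere 0 1)) (proj_line mul) (stereo_line mul one h)"
    by (rule homeomorphic_map_stereo_line)
  show "homeomorphic_map (clutched_bundle cl) (tautological_bundle mul)
     (\<lambda>c. (stereo_line mul one h (glue_proj c), frame_map c))"
    by (rule homeomorphic_map_tautological)
  fix s and p :: "(real^'n) \<times> real" assume p: "p \<in> hemisphere s"
  show "fst (stereo_line mul one h (glue_proj (clutch_point cl (s, p, w))), frame_map (clutch_point cl (s, p, w)))
      = stereo_line mul one h p" for w
    using p by (simp add: clutch_point_def glue_proj_point)
  show "linear (\<lambda>w. snd (stereo_line mul one h (glue_proj (clutch_point cl (s, p, w))), frame_map (clutch_point cl (s, p, w))))"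
    using p linear_frame_fibre by (simp add: frame_map_point)
qed

end

section \<open>Composition algebras in coordinates\<close>

text \<open>An isomorphism turns the given quadratic norm into the squared Euclidean norm, so bilinearity, unit
  and multiplicativity carry over from the abstract algebra to the model.\<close>

lemma euclidean_composition_algebra_transfer:
  assumes D: "composition_division_algebra mul one N" and \<phi>: "composition_iso mul N mulK \<phi>"
  shows "euclidean_composition_algebra mulK (\<phi> one)"
proof
  have hom: "\<And>u v. mulK (\<phi> u) (\<phi> v) = \<phi> (mul u v)"
    and norm: "\<And>u. (norm (\<phi> u))\<^sup>2 = N u" and surj: "\<And>y. \<exists>u. y = \<phi> u"
    using \<phi> by (auto simp: composition_iso_def bij_def surj_def)
  have unit: "\<And>u. mul one u = u" "\<And>u. mul u one = u"
    and N: "\<And>u v. N (mul u v) = N u * N v"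
    using D by (auto simp: composition_division_algebra_def)
  fix x y
  obtain u v where uvw: "x = \<phi> u" "y = \<phi> v"
    using surj by metis
  show "mulK (\<phi> one) x = x" "mulK x (\<phi> one) = x"
    by (simp_all add: uvw hom unit)
  have "(norm (mulK x y))\<^sup>2 = (norm x * norm y)\<^sup>2"
    by (simp add: uvw hom norm N power_mult_distrib)
  then show "norm (mulK x y) = norm x * norm y"
    by (simp add: power2_eq_iff_nonneg)
next
  have lin: "linear \<phi>" and hom: "\<And>u v. mulK (\<phi> u) (\<phi> v) = \<phi> (mul u v)"
    and surj: "\<And>y. \<exists>u. y = \<phi> u"
    using \<phi> by (auto simp: composition_iso_def bij_def surj_def)
  have bil: "bilinear mul"
    using D by (auto simp: composition_division_algebra_def)
  have [simp]: "\<phi> u + \<phi> v = \<phi> (u + v)" "r *\<^sub>R \<phi> u = \<phi> (r *\<^sub>R u)" for u v r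
    using lin by (simp_all add: linear_add linear_scale)
  show "bilinear mulK"
    unfolding bilinear_def
  proof (intro conjI allI linearI)
    fix x y z and r :: real
    obtain u v w where "x = \<phi> u" "y = \<phi> v" "z = \<phi> w"
      using surj by metis
    then show "mulK x (y + z) = mulK x y + mulK x z" "mulK x (r *\<^sub>R y) = r *\<^sub>R mulK x y"
        "mulK (y + z) x = mulK y x + mulK z x" "mulK (r *\<^sub>R y) x = r *\<^sub>R mulK y x"
      by (simp_all add: hom bilinear_ladd [OF bil] bilinear_radd [OF bil] bilinear_lmul [OF bil] bilinear_rmul [OF bil])
  qed
qed

lemma linear_from_coords: "linear (from_coords e)"
  by (rule linearI)
     (simp_all add: from_coords_def scaleR_add_left sum.distrib scaleR_sum_right)

lemma composition_norm_from_coords: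
  assumes D: "composition_division_algebra mul one N" and e: "orthonormal_basis N e"
  shows "N (from_coords e x) = (norm x)\<^sup>2"
proof -
  have bil: "bilinear (polar N)" and scale: "\<And>c u. N (c *\<^sub>R u) = c\<^sup>2 * N u"
    using D by (auto simp: composition_division_algebra_def)
  have "polar N u u = N u" for u
    using scale [of 2 u] by (simp add: polar_def scaleR_2)
  then have "N (from_coords e x) = polar N (from_coords e x) (from_coords e x)"
    by simp
  also have "\<dots> = (\<Sum>(r, s)\<in>UNIV \<times> UNIV. (x $ r * x $ s) * polar N (e r) (e s))"
    unfolding from_coords_def bilinear_sum [OF bil]
    by (simp add: bilinear_lmul [OF bil] bilinear_rmul [OF bil] mult_ac)
  also have "\<dots> = (\<Sum>r\<in>UNIV. \<Sum>s\<in>UNIV. if r = s then x $ r * x $ s else 0)"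
    unfolding sum.cartesian_product [symmetric]
    using e by (intro sum.cong) (auto simp: orthonormal_basis_def)
  also have "\<dots> = (norm x)\<^sup>2"
    by (simp add: power2_norm_eq_inner inner_vec_def)
  finally show ?thesis .
qed

lemma bij_from_coords:
  assumes D: "composition_division_algebra mul one N" and e: "orthonormal_basis N e"
  shows "bij (from_coords e)"
proof -
  have "N 0 = 0"
    using D composition_division_algebra_def [of mul one N] by (metis power_zero_numeral mult_zero_left scale_zero_left)
  then have "from_coords e x = 0 \<Longrightarrow> x = 0" for x
    using composition_norm_from_coords [OF D e, of x] by simp
  then have "inj (from_coords e)"
    by (simp add: linear_injective_0 [OF linear_from_coords])
  moreover have "range (from_coords e) = UNIV"
  proof -
    have "e r \<in> range (from_coords e)" for r
    proof -
      have "from_coords e (axis r 1) = e r"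
        by (simp add: from_coords_def axis_def if_distrib [of "\<lambda>c. c *\<^sub>R _"] cong: if_cong)
      then show ?thesis by (metis rangeI)
    qed
    then have "span (range e) \<subseteq> range (from_coords e)"
      using linear_subspace_image [OF linear_from_coords subspace_UNIV] by (intro span_minimal) auto
    then show ?thesis
      using e by (auto simp: orthonormal_basis_def)
  qed
  ultimately show ?thesis
    by (simp add: bij_def)
qed

lemma quat_mult_assoc: "quat_mult (quat_mult p q) r = quat_mult p (quat_mult q r)"
  by (cases p; cases q; cases r) (simp add: algebra_simps)

lemma quat_mult_one: "quat_mult u (1, 0) = u" "quat_mult (1, 0) u = u"
  by (cases u; simp)+

lemma oct_mult_one: "oct_mult u ((1, 0), 0) = u"
  by (cases u) (auto simp: quat_mult_one zero_prod_def split: prod.split)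

text \<open>The algebra in the coordinates of an orthonormal basis. The coordinate space becomes a Euclidean
  composition algebra, whose left multiplication by \<open>x\<close> has the matrix \<open>lambda_map mul e x\<close>.\<close>

locale coordinate_algebra =
  fixes mul :: "'a::real_vector \<Rightarrow> 'a \<Rightarrow> 'a" and one :: 'a and N :: "'a \<Rightarrow> real"
    and e :: "'n::finite \<Rightarrow> 'a"
  assumes D: "composition_division_algebra mul one N" and e: "orthonormal_basis N e"
begin

lemma from_to_coords [simp]: "from_coords e (to_coords e u) = u"
  and to_from_coords [simp]: "to_coords e (from_coords e x) = x"
  using bij_from_coords [OF D e] by (simp_all add: to_coords_def bij_is_surj surj_f_inv_f bij_is_inj)

lemma norm_coords: "N (from_coords e x) = (norm x)\<^sup>2"
  by (rule composition_norm_from_coords [OF D e])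

lemma linear_to_coords: "linear (to_coords e)"
proof (rule linearI)
  fix u v and r :: real
  have "from_coords e (to_coords e u + to_coords e v) = u + v" "from_coords e (r *\<^sub>R to_coords e u) = r *\<^sub>R u"
    by (simp_all add: linear_add [OF linear_from_coords] linear_scale [OF linear_from_coords])
  then show "to_coords e (u + v) = to_coords e u + to_coords e v" "to_coords e (r *\<^sub>R u) = r *\<^sub>R to_coords e u"
    by (metis to_from_coords)+
qed

definition coord_mul :: "real^'n \<Rightarrow> real^'n \<Rightarrow> real^'n" (infixl \<open>\<odot>\<close> 70) where
  "x \<odot> y = to_coords e (mul (from_coords e x) (from_coords e y))"

lemma composition_iso_to_coords: "composition_iso mul N coord_mul (to_coords e)"
proof -
  have "bij (to_coords e)"
    using bij_from_coords [OF D e] by (simp add: to_coords_def bij_imp_bij_inv)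
  moreover have "(norm (to_coords e u))\<^sup>2 = N u" for u
    using norm_coords [of "to_coords e u"] by simp
  ultimately show ?thesis
    by (simp add: composition_iso_def linear_to_coords coord_mul_def)
qed

sublocale V: euclidean_composition_algebra coord_mul "to_coords e one"
  by (rule euclidean_composition_algebra_transfer [OF D composition_iso_to_coords])

lemma lambda_map_apply: "lambda_map mul e x *v w = x \<odot> w"
proof -
  have "lambda_map mul e x = matrix (coord_mul x)"
    by (simp add: lambda_map_def left_mult_matrix_def coord_mul_def [abs_def])
  then show ?thesis
    by (simp add: V.linear_mul)
qed

lemma hopf_clutching_lambda:
  assumes \<phi>: "composition_iso mul N mulK \<phi>" and oneK: "\<And>u. mulK u oneK = u"
  shows "hopf_clutching mulK oneK (\<phi> \<circ> from_coords e) (lambda_map mul e)"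
proof -
  have K: "euclidean_composition_algebra mulK (\<phi> one)"
    by (rule euclidean_composition_algebra_transfer [OF D \<phi>])
  have "\<phi> one = oneK"
    using oneK [of "\<phi> one"] euclidean_composition_algebra.one_mul [OF K, of oneK] by simp
  with K have "euclidean_composition_algebra mulK oneK"
    by simp
  moreover have "linear (\<phi> \<circ> from_coords e)"
    using \<phi> linear_from_coords by (auto simp: composition_iso_def intro: linear_compose)
  moreover have "bij (\<phi> \<circ> from_coords e)"
    using \<phi> bij_from_coords [OF D e] by (auto simp: composition_iso_def intro: bij_comp)
  moreover have "norm ((\<phi> \<circ> from_coords e) x) = norm x" for x
  proof -
    have "(norm ((\<phi> \<circ> from_coords e) x))\<^sup>2 = (norm x)\<^sup>2"
      using \<phi> norm_coords by (simp add: composition_iso_def)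
    then show ?thesis
      by (simp add: power2_eq_iff_nonneg)
  qed
  moreover have "(\<phi> \<circ> from_coords e) (lambda_map mul e x *v w)
      = mulK ((\<phi> \<circ> from_coords e) x) ((\<phi> \<circ> from_coords e) w)" for x w
    using \<phi> by (simp add: lambda_map_apply coord_mul_def composition_iso_def)
  ultimately show ?thesis
    by (simp add: hopf_clutching_def hopf_clutching_axioms_def)
qed

lemma tautological_clutching_lambda:
  assumes \<phi>: "composition_iso mul N mulK \<phi>" and oneK: "\<And>u. mulK u oneK = u"
    and assoc: "\<And>a b c. mulK (mulK a b) c = mulK a (mulK b c)"
  shows "real_clutching_of_tautological mulK oneK (\<phi> \<circ> from_coords e) (lambda_map mul e)"
proof -
  interpret associative_hopf_clutching mulK oneK "\<phi> \<circ> from_coords e" "lambda_map mul e"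
    using hopf_clutching_lambda [OF \<phi> oneK] assoc
    by (simp add: associative_hopf_clutching_def associative_hopf_clutching_axioms_def)
  show ?thesis
    by (rule real_clutching_of_tautological)
qed

text \<open>The reflection \<open>conjugate\<close> of the octonions is their Cayley--Dickson conjugation, so the Hopf map of
  the general development is \<open>oct_hopf\<close>.\<close>

lemma octonionic_clutching_lambda:
  fixes \<phi> :: "'a \<Rightarrow> oct"
  assumes \<phi>: "composition_iso mul N oct_mult \<phi>"
  shows "octonionic_hopf_clutching (\<phi> \<circ> from_coords e) (lambda_map mul e)"
proof -
  interpret hopf_clutching oct_mult "((1, 0), 0)" "\<phi> \<circ> from_coords e" "lambda_map mul e"
    by (rule hopf_clutching_lambda [OF \<phi> oct_mult_one])
  have "conjugate u = oct_cnj u" for u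
    unfolding conjugate_def
    by (cases u rule: oct_cnj.cases)
       (auto simp: inner_complex_def zero_prod_def complex_eq_iff scaleR_prod_def minus_prod_def)
  then have hopf: "hopf_map = oct_hopf"
    by (simp add: fun_eq_iff hopf_map_def oct_hopf_def)
  show ?thesis
    unfolding octonionic_hopf_clutching_def
  proof (intro conjI exI ballI allI impI)
    show "homeomorphic_map (top_of_set (sphere 0 1)) (top_of_set (sphere 0 1))
       (\<lambda>p. ((\<phi> \<circ> from_coords e) (fst p), snd p :: real))"
      using homeomorphic_map_lift_base by (simp add: lift_base_def [abs_def])
    show "homeomorphic_map (unit_sphere_bundle (lambda_map mul e)) (top_of_set (sphere 0 1)) frame_map"
      by (rule homeomorphic_map_unit_sphere_bundle)
    fix s and p :: "(real^'n) \<times> real" assume p: "p \<in> hemisphere s"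
    show "oct_hopf (frame_map (clutch_point (lambda_map mul e) (s, p, w))) = ((\<phi> \<circ> from_coords e) (fst p), snd p)"
      if "norm w = 1" for w
      using hopf_map_frame_map [OF p, of w] that by (simp add: hopf lift_base_def)
    show "linear (\<lambda>w. hopf_frame s (lift_base p) ((\<phi> \<circ> from_coords e) w))"
      by (rule linear_frame_fibre)
    show "frame_map (clutch_point (lambda_map mul e) (s, p, w)) = hopf_frame s (lift_base p) ((\<phi> \<circ> from_coords e) w)" for w
      using p by (rule frame_map_point)
  qed
qed

end

section \<open>Affine charts of the real projective space\<close>

text \<open>The value of such a map at \<open>r\<close> is the element of its range that has as many predecessors in the range
  as \<open>r\<close> has in the index type.\<close>

lemma strict_mono_onto_unique:
  fixes f g :: "'n::{finite,linorder} \<Rightarrow> 'm::linorder"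
  assumes f: "strict_mono f" and g: "strict_mono g" and eq: "range f = range g"
  shows "f = g"
proof -
  have below: "card {y \<in> range f. y < k r} = card {s. s < r}"
    if k: "strict_mono k" "range k = range f" for k :: "'n \<Rightarrow> 'm" and r
  proof -
    have "{y \<in> range f. y < k r} = k ` {s. s < r}"
      unfolding k(2) [symmetric] using strict_mono_less [OF k(1)] by auto
    then show ?thesis
      using k(1) by (simp add: card_image inj_on_def strict_mono_eq)
  qed
  have "f r = g r" for r
  proof -
    have not_less: "\<not> x < y" if "x \<in> range f" "y \<in> range f" "card {z \<in> range f. z < x} = card {z \<in> range f. z < y}" for x y
    proof
      assume "x < y"
      then have "{z \<in> range f. z < x} \<subset> {z \<in> range f. z < y}"
        using that(1) by auto
      then have "card {z \<in> range f. z < x} < card {z \<in> range f. z < y}"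
        by (intro psubset_card_mono) auto
      with that(3) show False by simp
    qed
    have "card {z \<in> range f. z < f r} = card {z \<in> range f. z < g r}"
      using below [OF f refl] below [OF g] eq by simp
    moreover have "f r \<in> range f" "g r \<in> range f"
      using eq by auto
    ultimately have "\<not> f r < g r" "\<not> g r < f r"
      using not_less [of "f r" "g r"] not_less [of "g r" "f r"] by simp_all
    then show ?thesis
      by simp
  qed
  then show ?thesis by blast
qed

text \<open>The \<open>k\<close>-th index is sent to the \<open>k\<close>-th entry of the sorted list of elements of \<open>A\<close>.\<close>

lemma strict_mono_onto_exists:
  fixes A :: "'m::{finite,linorder} set"
  assumes "card A = CARD('n::{finite,linorder})"
  obtains f :: "'n::{finite,linorder} \<Rightarrow> 'm" where "strict_mono f" "range f = A"
proof
  let ?rank = "\<lambda>r :: 'n. card {s. s < r}"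
  let ?f = "\<lambda>r. sorted_list_of_set A ! ?rank r"
  have len: "length (sorted_list_of_set A) = CARD('n)"
    using assms by simp
  have mono: "?rank r < ?rank s" if "r < s" for r s
    using that by (intro psubset_card_mono) auto
  have bound: "?rank r < CARD('n)" for r
    by (intro psubset_card_mono) auto
  have "?f r < ?f s" if "r < s" for r s
    by (rule sorted_wrt_nth_less [OF strict_sorted_list_of_set mono [OF that]]) (simp only: len bound)
  then show "strict_mono ?f"
    by (simp add: strict_mono_def)
  then have "card (range ?f) = card A"
    using assms by (simp add: card_image strict_mono_imp_inj_on)
  moreover have "?f r \<in> A" for r
    using nth_mem [of "?rank r" "sorted_list_of_set A"] bound [of r] len by simp
  then have "range ?f \<subseteq> A"
    by blast
  ultimately show "range ?f = A"
    by (simp add: card_subset_eq)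
qed

lemma skip_index_props:
  fixes i :: "'m::{finite,linorder}"
  assumes "CARD('m) = CARD('n::{finite,linorder}) + 1"
  shows "strict_mono (skip_index i :: 'n \<Rightarrow> 'm)" "range (skip_index i :: 'n \<Rightarrow> 'm) = UNIV - {i}"
proof -
  have "card (UNIV - {i}) = CARD('n)"
    using assms by (simp add: card_Diff_singleton)
  then obtain f :: "'n \<Rightarrow> 'm" where "strict_mono f \<and> range f = UNIV - {i}"
    using strict_mono_onto_exists by metis
  moreover from this have "skip_index i = f"
    unfolding skip_index_def by (intro the_equality) (simp_all add: strict_mono_onto_unique)
  ultimately show "strict_mono (skip_index i :: 'n \<Rightarrow> 'm)" "range (skip_index i :: 'n \<Rightarrow> 'm) = UNIV - {i}"
    by auto
qed

lemma topspace_real_proj_space: "topspace real_proj_space = {span {\<alpha>} | \<alpha>. \<alpha> \<noteq> 0}"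
  by (auto simp: real_proj_space_def topspace_quotient_topology)

lemma quotient_map_span: "quotient_map (top_of_set (- {0})) real_proj_space (\<lambda>\<alpha>. span {\<alpha>})"
  by (simp add: real_proj_space_def quotient_map_quotient_topology)

text \<open>The chosen homogeneous coordinates are determined up to a nonzero factor, which cancels in every
  ratio of coordinates.\<close>

lemma homog_coords_span:
  assumes "\<alpha> \<noteq> 0"
  obtains c where "c \<noteq> 0" "homog_coords (span {\<alpha>}) = c *\<^sub>R \<alpha>"
proof -
  have "homog_coords (span {\<alpha>}) \<noteq> 0 \<and> span {homog_coords (span {\<alpha>})} = span {\<alpha>}"
    unfolding homog_coords_def by (rule someI) (use assms in auto)
  moreover from this have "homog_coords (span {\<alpha>}) \<in> span {\<alpha>}"
    using span_base by blast
  ultimately show ?thesis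
    using that by (auto simp: span_singleton)
qed

lemma span_mem_std_open:
  assumes "\<alpha> \<noteq> 0"
  shows "span {\<alpha>} \<in> std_open i \<longleftrightarrow> \<alpha> $ i \<noteq> 0"
proof -
  obtain c where "c \<noteq> 0" "homog_coords (span {\<alpha>}) = c *\<^sub>R \<alpha>"
    using homog_coords_span [OF assms] .
  moreover have "span {\<alpha>} \<in> topspace real_proj_space"
    using assms unfolding topspace_real_proj_space by blast
  ultimately show ?thesis
    by (simp add: std_open_def)
qed

lemma std_openE:
  assumes "p \<in> std_open i"
  obtains \<alpha> where "\<alpha> $ i \<noteq> 0" "p = span {\<alpha>}"
proof -
  obtain \<alpha> where "\<alpha> \<noteq> 0" "p = span {\<alpha>}"
    using assms unfolding std_open_def topspace_real_proj_space by blast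
  with assms that show ?thesis
    using span_mem_std_open by blast
qed

lemma std_open_subset: "std_open i \<subseteq> topspace real_proj_space"
  by (auto simp: std_open_def)

lemma std_open_cover:
  assumes "p \<in> topspace real_proj_space"
  shows "\<exists>i. p \<in> std_open i"
proof -
  obtain \<alpha> where \<alpha>: "\<alpha> \<noteq> 0" "p = span {\<alpha>}"
    using assms unfolding topspace_real_proj_space by blast
  then obtain i where "\<alpha> $ i \<noteq> 0"
    by (auto simp: vec_eq_iff)
  with \<alpha> show ?thesis
    using span_mem_std_open by blast
qed

lemma span_in_std_open: "\<alpha> $ i \<noteq> 0 \<Longrightarrow> span {\<alpha>} \<in> std_open i"
  by (subst span_mem_std_open) auto

lemma preimage_std_open: "{\<alpha> \<in> topspace (top_of_set (- {0})). span {\<alpha>} \<in> std_open i} = {\<alpha>. \<alpha> $ i \<noteq> 0}"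
  by (auto simp: span_mem_std_open span_in_std_open)

lemma coord_point_in_std_open: "coord_point i \<in> std_open i"
  by (simp add: coord_point_def span_in_std_open)

lemma openin_std_open: "openin real_proj_space (std_open i)"
proof -
  have "open {\<alpha> :: real^_. \<alpha> $ i \<noteq> 0}"
    by (intro open_Collect_neq continuous_intros)
  then have "openin (top_of_set (- {0})) {\<alpha> \<in> topspace (top_of_set (- {0})). span {\<alpha>} \<in> std_open i}"
    unfolding preimage_std_open by (subst openin_open_eq) auto
  then show ?thesis
    using std_open_subset [of i]
    by (simp add: real_proj_space_def openin_quotient_topology topspace_quotient_topology)
qed

definition chart :: "'m::{finite,linorder} \<Rightarrow> (real^'m::_) set \<Rightarrow> real^'n::{finite,linorder}" where
  "chart i p = (\<chi> r. homog_coords p $ skip_index i r / homog_coords p $ i)"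

lemma affine_coord_chart: "affine_coord e i p = from_coords e (chart i p)"
  by (simp add: affine_coord_def from_coords_def chart_def)

lemma chart_span:
  assumes "\<alpha> $ i \<noteq> 0"
  shows "chart i (span {\<alpha>}) = (\<chi> r. \<alpha> $ skip_index i r / \<alpha> $ i)"
proof -
  have "\<alpha> \<noteq> 0"
    using assms by auto
  then obtain c where "c \<noteq> 0" "homog_coords (span {\<alpha>}) = c *\<^sub>R \<alpha>"
    using homog_coords_span by metis
  then show ?thesis
    by (simp add: chart_def)
qed

definition chart_inv :: "'m::{finite,linorder} \<Rightarrow> real^'n::{finite,linorder} \<Rightarrow> (real^'m::_) set" where
  "chart_inv i x = span {\<chi> k. if k = i then 1 else x $ inv (skip_index i) k}"

text \<open>The parameters carry nothing but the two index types, whose sizes are related.\<close>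

locale projective_charts =
  fixes homog_index :: "'m::{finite,linorder} itself" and basis_index :: "'n::{finite,linorder} itself"
  assumes card: "CARD('m) = CARD('n) + 1"
begin

abbreviation skip :: "'m \<Rightarrow> 'n \<Rightarrow> 'm" where "skip \<equiv> skip_index"
abbreviation U :: "'m \<Rightarrow> (real^'m::_) set set" where "U \<equiv> std_open"
abbreviation ch :: "'m \<Rightarrow> (real^'m::_) set \<Rightarrow> real^'n::_" where "ch \<equiv> chart"

lemma inj_skip: "inj (skip i)"
  using skip_index_props(1) [OF card] strict_mono_imp_inj_on by blast

lemma skip_neq [simp]: "skip i r \<noteq> i"
  using skip_index_props(2) [OF card, of i] by (metis DiffD2 rangeI singletonI)

lemma skip_onto: "k \<noteq> i \<Longrightarrow> \<exists>r. k = skip i r"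
  using skip_index_props(2) [OF card, of i] by (metis DiffI UNIV_I imageE singletonD)

lemma homeomorphic_map_chart: "homeomorphic_map (subtopology real_proj_space (U i)) euclidean (ch i)"
proof -
  let ?a = "\<lambda>x :: real^'n::_. (\<chi> k. if k = i then 1 else x $ inv (skip i) k) :: real^'m::_"
  have a: "?a x $ i \<noteq> 0" "?a x \<noteq> 0" for x
    by (auto simp: vec_eq_iff)
  have "homeomorphic_maps (subtopology real_proj_space (U i)) euclidean (ch i) (chart_inv i)"
    unfolding homeomorphic_maps_def
  proof (intro conjI ballI)
    have q: "quotient_map (subtopology (top_of_set (- {0})) {\<alpha>. \<alpha> $ i \<noteq> 0}) (subtopology real_proj_space (U i)) (\<lambda>\<alpha>. span {\<alpha>})"
      by (rule quotient_map_restriction [OF quotient_map_span preimage_std_open]) (simp add: openin_std_open)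
    have "continuous_on {\<alpha>. \<alpha> $ i \<noteq> 0} (\<lambda>\<alpha>. (\<chi> r. \<alpha> $ skip i r / \<alpha> $ i) :: real^'n::_)"
      by (intro continuous_intros) auto
    then have "continuous_on (- {0} \<inter> {\<alpha>. \<alpha> $ i \<noteq> 0}) (\<lambda>\<alpha>. ch i (span {\<alpha>}))"
      by (rule continuous_on_eq [OF continuous_on_subset]) (auto simp: chart_span)
    then show "continuous_map (subtopology real_proj_space (U i)) euclidean (ch i)"
      by (intro continuous_compose_quotient_map [OF q]) (simp add: subtopology_subtopology o_def)
    have "continuous_on UNIV ?a"
    proof (rule continuous_on_vec_lambda)
      show "continuous_on UNIV (\<lambda>x :: real^'n::_. if k = i then 1 else x $ inv (skip i) k)" for k
        by (cases "k = i") (auto intro: continuous_intros)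
    qed
    then have "continuous_map euclidean (top_of_set (- {0})) ?a"
      using a(2) by (simp add: continuous_map_in_subtopology Pi_iff)
    from continuous_map_compose [OF this quotient_imp_continuous_map [OF quotient_map_span]]
    have "continuous_map euclidean real_proj_space (chart_inv i :: real^'n::_ \<Rightarrow> _)"
      by (simp add: chart_inv_def [abs_def] o_def)
    then show "continuous_map euclidean (subtopology real_proj_space (U i)) (chart_inv i :: real^'n::_ \<Rightarrow> _)"
      by (simp add: continuous_map_in_subtopology chart_inv_def Pi_iff span_in_std_open)
  next
    fix p assume "p \<in> topspace (subtopology real_proj_space (U i))"
    then obtain \<alpha> where \<alpha>: "\<alpha> $ i \<noteq> 0" "p = span {\<alpha>}"
      using std_openE by auto
    have "(\<chi> k. if k = i then 1 else ch i p $ inv (skip i) k) = (1 / \<alpha> $ i) *\<^sub>R \<alpha>"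
      using \<alpha> skip_onto [of _ i] by (auto simp: vec_eq_iff chart_span inv_f_f [OF inj_skip] f_inv_into_f image_iff)
    then have "chart_inv i (ch i p) = span {(1 / \<alpha> $ i) *\<^sub>R \<alpha>}"
      by (simp add: chart_inv_def)
    also have "\<dots> = p"
      using \<alpha> span_image_scale [of "{\<alpha>}" "\<lambda>_. 1 / \<alpha> $ i"] by simp
    finally show "chart_inv i (ch i p) = p" .
  next
    fix x :: "real^'n::_"
    show "ch i (chart_inv i x) = x"
      by (simp add: chart_inv_def chart_span vec_eq_iff inv_f_f [OF inj_skip])
  qed
  then show ?thesis
    by (rule homeomorphic_maps_imp_map)
qed

lemma inj_on_chart: "inj_on (ch i) (U i)"
  using homeomorphic_imp_injective_map [OF homeomorphic_map_chart, of i] std_open_subset [of i]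
  by (simp add: Int_absorb1)

lemma chart_onto: "ch i ` U i = UNIV"
  using homeomorphic_imp_surjective_map [OF homeomorphic_map_chart, of i] std_open_subset [of i]
  by (simp add: Int_absorb1)

lemma chart_eq_0_iff:
  assumes "p \<in> U i"
  shows "ch i p = 0 \<longleftrightarrow> p = coord_point i"
proof -
  have "ch i (coord_point i) = 0"
    by (simp add: coord_point_def chart_span vec_eq_iff) (simp add: axis_def)
  then show ?thesis
    using assms coord_point_in_std_open [of i] inj_on_chart [of i] by (metis inj_onD)
qed

text \<open>Up to a nonzero factor, the homogeneous coordinate in position \<open>j\<close> is an entry of the affine
  coordinate in the chart \<open>i\<close>.\<close>

lemma chart_neq_0:
  assumes "p \<in> U i" "p \<in> U j" "i \<noteq> j"
  shows "ch i p \<noteq> 0"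
proof -
  obtain \<alpha> where \<alpha>: "\<alpha> $ i \<noteq> 0" "p = span {\<alpha>}"
    using std_openE assms by blast
  then have "\<alpha> \<noteq> 0"
    by auto
  then have "\<alpha> $ j \<noteq> 0"
    using \<alpha> assms span_mem_std_open by blast
  moreover obtain r where "j = skip i r"
    using skip_onto [of j i] assms(3) by auto
  ultimately have "ch i p $ r \<noteq> 0"
    using \<alpha> by (simp add: chart_span)
  then show ?thesis by auto
qed

lemma punctured_iff:
  assumes "p \<in> U i"
  shows "p \<in> punctured_space \<longleftrightarrow> ch i p \<noteq> 0"
proof -
  have "p \<noteq> coord_point j" if "j \<noteq> i" for j
  proof
    assume "p = coord_point j"
    then have "p \<in> U j"
      by (simp add: coord_point_in_std_open)
    with \<open>p = coord_point j\<close> show False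
      using chart_eq_0_iff [of p j] chart_neq_0 [of p j i] assms that by simp
  qed
  then have "p \<in> range (coord_point :: 'm \<Rightarrow> _) \<longleftrightarrow> p = coord_point i"
    by (metis rangeE rangeI)
  moreover have "p \<in> topspace real_proj_space"
    using assms std_open_subset by blast
  ultimately show ?thesis
    using chart_eq_0_iff [OF assms] by (simp add: punctured_space_def)
qed

lemma continuous_map_chart: "continuous_map (subtopology real_proj_space (U i)) euclidean (ch i)"
  using homeomorphic_map_chart homeomorphic_imp_continuous_map by blast

lemma openin_punctured_space: "openin real_proj_space (punctured_space :: (real^'m::_) set set)"
proof -
  have eq: "(punctured_space :: (real^'m::_) set set) = (\<Union>i. {p \<in> U i. ch i p \<in> - {0}})"
  proof (intro equalityI subsetI)
    fix p :: "(real^'m::_) set" assume p: "p \<in> punctured_space"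
    then obtain i where "p \<in> U i"
      using std_open_cover by (auto simp: punctured_space_def)
    with p show "p \<in> (\<Union>i. {p \<in> U i. ch i p \<in> - {0}})"
      using punctured_iff by auto
  next
    fix p :: "(real^'m::_) set" assume "p \<in> (\<Union>i. {p \<in> U i. ch i p \<in> - {0}})"
    then show "p \<in> punctured_space"
      using punctured_iff by auto
  qed
  moreover have "openin real_proj_space {p \<in> U i. ch i p \<in> - {0}}" for i
  proof (rule openin_trans_full)
    have "openin (subtopology real_proj_space (U i)) {p \<in> topspace (subtopology real_proj_space (U i)). ch i p \<in> - {0}}"
      by (rule openin_continuous_map_preimage [OF continuous_map_chart]) auto
    then show "openin (subtopology real_proj_space (U i)) {p \<in> U i. ch i p \<in> - {0}}"
      using std_open_subset [of i] by (simp add: Int_absorb1)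
  qed (rule openin_std_open)
  ultimately have "openin real_proj_space (\<Union>i. {p \<in> U i. ch i p \<in> - {0}})"
    by (intro openin_Union) blast
  then show ?thesis
    unfolding eq .
qed

text \<open>In homogeneous coordinates the ball is given by \<open>norm (\<alpha>\<^sub>k)\<^sub>k\<^sub>\<noteq>\<^sub>i \<le> \<rho> \<bar>\<alpha>\<^sub>i\<bar>\<close>. As this closed condition
  forces \<open>\<alpha>\<^sub>i \<noteq> 0\<close>, the ball is closed in the whole projective space, its frontier stays inside the
  chart and can be computed there.\<close>

lemma chart_ball_frontier:
  assumes B: "B = {p \<in> U i. norm (ch i p) \<le> \<rho>}" and \<rho>: "\<rho> > 0"
  shows "real_proj_space frontier_of B = {p \<in> U i. norm (ch i p) = \<rho>}"
proof -
  let ?P = "real_proj_space :: (real^'m::_) set topology"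
  have cl: "closedin ?P B"
  proof -
    have eq: "{\<alpha> \<in> topspace (top_of_set (- {0})). span {\<alpha>} \<in> B}
        = - {0} \<inter> {\<alpha>. norm (\<chi> r. \<alpha> $ skip i r) \<le> \<rho> * \<bar>\<alpha> $ i\<bar>}" (is "?L = ?R")
    proof -
      have "\<alpha> \<in> ?L \<longleftrightarrow> \<alpha> \<in> ?R" for \<alpha>
      proof (cases "\<alpha> $ i = 0")
        case True
        have "\<alpha> = 0" if "norm (\<chi> r. \<alpha> $ skip i r) \<le> 0"
        proof -
          have "\<alpha> $ skip i r = 0" for r
            using that by (simp add: vec_eq_iff)
          then have "\<alpha> $ k = 0" for k
            using True skip_onto [of k i] by metis
          then show ?thesis
            by (simp add: vec_eq_iff)
        qed
        with True show ?thesis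
          by (auto simp: B span_mem_std_open)
      next
        case False
        then have "ch i (span {\<alpha>}) = (1 / \<alpha> $ i) *\<^sub>R (\<chi> r. \<alpha> $ skip i r)"
          by (simp add: chart_span vec_eq_iff)
        then have "norm (ch i (span {\<alpha>})) = norm (\<chi> r. \<alpha> $ skip i r) / \<bar>\<alpha> $ i\<bar>"
          by simp
        moreover have "\<alpha> \<noteq> 0"
          using False by auto
        ultimately show ?thesis
          using False by (simp add: B span_mem_std_open divide_le_eq)
      qed
      then show ?thesis by blast
    qed
    have "closed {\<alpha>. norm (\<chi> r. \<alpha> $ skip i r) \<le> \<rho> * \<bar>\<alpha> $ i\<bar>}"
      by (intro closed_Collect_le continuous_intros)
    then have "closedin (top_of_set (- {0})) {\<alpha> \<in> topspace (top_of_set (- {0})). span {\<alpha>} \<in> B}"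
      unfolding eq by (rule closedin_closed_Int)
    moreover have "B \<subseteq> topspace ?P"
      using std_open_subset by (auto simp: B)
    ultimately show ?thesis
      using quotient_map_span [unfolded quotient_map_closedin, THEN conjunct2, THEN spec, of B] by blast
  qed
  let ?F = "?P frontier_of B"
  have FU: "?F \<subseteq> U i"
    using frontier_of_subset_closedin [OF cl] by (auto simp: B)
  then have "subtopology ?P (U i) frontier_of B = ?F"
    using frontier_of_subtopology_open [OF openin_std_open] by blast
  moreover have BU: "B \<subseteq> topspace (subtopology ?P (U i))"
    using std_open_subset by (auto simp: B)
  ultimately have "ch i ` ?F = euclidean frontier_of (ch i ` B)"
    using homeomorphic_map_frontier_of [OF homeomorphic_map_chart BU] by simp
  also have "ch i ` B = cball 0 \<rho>"
  proof -
    have "x \<in> ch i ` B" if x: "norm x \<le> \<rho>" for x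
    proof -
      obtain p where "p \<in> U i" "x = ch i p"
        using chart_onto [of i] by blast
      with x show ?thesis
        by (auto simp: B)
    qed
    then show ?thesis
      by (auto simp: B)
  qed
  finally have F: "ch i ` ?F = sphere 0 \<rho>"
    using \<rho> by (simp add: frontier_cball)
  show ?thesis
  proof (intro equalityI subsetI)
    fix p assume "p \<in> ?F"
    then show "p \<in> {p \<in> U i. norm (ch i p) = \<rho>}"
      using F FU by auto
  next
    fix p assume p: "p \<in> {p \<in> U i. norm (ch i p) = \<rho>}"
    then have "ch i p \<in> ch i ` ?F"
      using F by simp
    then show "p \<in> ?F"
      using p FU inj_on_chart [of i] by (auto dest: inj_onD)
  qed
qed

end

section \<open>Matrices of left multiplications\<close>

lemma continuous_map_matrix_matrix_mult:
  fixes A :: "'x \<Rightarrow> real^'n^'m" and B :: "'x \<Rightarrow> real^'k^'n"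
  assumes A: "continuous_map X euclidean A" and B: "continuous_map X euclidean B"
  shows "continuous_map X euclidean (\<lambda>x. A x ** B x)"
proof -
  have "continuous_map X euclidean (\<lambda>x. (A x, B x))"
    using A B by (simp add: continuous_map_pairwise o_def flip: prod_topology_euclidean)
  moreover have "continuous_on UNIV (\<lambda>z :: (real^'n^'m) \<times> (real^'k^'n). fst z ** snd z)"
    unfolding matrix_matrix_mult_def by (intro continuous_intros)
  then have "continuous_map euclidean euclidean (\<lambda>z :: (real^'n^'m) \<times> (real^'k^'n). fst z ** snd z)"
    by simp
  ultimately have "continuous_map X euclidean ((\<lambda>z. fst z ** snd z) \<circ> (\<lambda>x. (A x, B x)))"
    by (rule continuous_map_compose)
  then show ?thesis by (simp add: o_def)
qed

lemma continuous_on_det: "continuous_on S (det :: real^'n^'n \<Rightarrow> real)"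
  unfolding det_def [abs_def] by (intro continuous_intros)

lemma matrix_inv_unique:
  fixes A B :: "real^'n^'n"
  assumes "A ** B = mat 1"
  shows "matrix_inv A = B"
proof -
  have BA: "B ** A = mat 1"
    using assms matrix_left_right_inverse by blast
  have "A ** matrix_inv A = mat 1 \<and> matrix_inv A ** A = mat 1"
    unfolding matrix_inv_def by (rule someI [of _ B]) (simp add: assms BA)
  then show ?thesis
    using BA by (metis matrix_mul_assoc matrix_mul_lid matrix_mul_rid)
qed

context coordinate_algebra
begin

lemma lambda_map_add: "lambda_map mul e (x + y) = lambda_map mul e x + lambda_map mul e y"
  by (simp add: matrix_eq lambda_map_apply matrix_vector_mult_add_rdistrib V.mul_simps)

lemma lambda_map_scaleR: "lambda_map mul e (c *\<^sub>R x) = c *\<^sub>R lambda_map mul e x"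
  by (simp add: matrix_eq lambda_map_apply scaleR_matrix_vector_assoc [symmetric] V.mul_simps)

lemma continuous_on_lambda_map: "continuous_on S (lambda_map mul e)"
proof -
  have "linear (lambda_map mul e)"
    by (intro linearI lambda_map_add lambda_map_scaleR)
  then show ?thesis
    by (simp add: linear_continuous_on linear_conv_bounded_linear)
qed

lemma continuous_map_lambda_map:
  "continuous_map X euclidean f \<Longrightarrow> continuous_map X euclidean (\<lambda>p. lambda_map mul e (f p))"
  using continuous_map_compose [of X euclidean f euclidean "lambda_map mul e"] continuous_on_lambda_map
  by (simp add: o_def)

definition inverse_point :: "real^'n \<Rightarrow> real^'n" where
  "inverse_point x = (1 / (norm x)\<^sup>2) *\<^sub>R V.conjugate x"

lemma lambda_map_inverse_point:
  assumes "x \<noteq> 0"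
  shows "lambda_map mul e x ** lambda_map mul e (inverse_point x) = mat 1"
  using assms
  by (simp add: matrix_eq lambda_map_apply inverse_point_def V.mul_simps V.mul_conj_mul
      flip: matrix_vector_mul_assoc)

lemma matrix_inv_lambda_map: "x \<noteq> 0 \<Longrightarrow> matrix_inv (lambda_map mul e x) = lambda_map mul e (inverse_point x)"
  by (rule matrix_inv_unique [OF lambda_map_inverse_point])

lemma lambda_map_inverse:
  assumes "x \<noteq> 0"
  shows "lambda_map mul e x ** matrix_inv (lambda_map mul e x) = mat 1"
    and "matrix_inv (lambda_map mul e x) ** lambda_map mul e x = mat 1"
  using lambda_map_inverse_point [OF assms] matrix_inv_lambda_map [OF assms] matrix_left_right_inverse by auto

lemma continuous_map_matrix_inv_lambda_map:
  assumes f: "continuous_map X euclidean f" and nz: "\<And>p. p \<in> topspace X \<Longrightarrow> f p \<noteq> 0"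
  shows "continuous_map X euclidean (\<lambda>p. matrix_inv (lambda_map mul e (f p)))"
proof -
  have "continuous_on (- {0}) inverse_point"
    unfolding inverse_point_def [abs_def] by (intro continuous_intros V.continuous_on_conj) auto
  moreover have "continuous_map X (top_of_set (- {0})) f"
    using f nz by (simp add: continuous_map_in_subtopology Pi_iff)
  ultimately have "continuous_map X euclidean (\<lambda>p. inverse_point (f p))"
    using continuous_map_compose [of X "top_of_set (- {0})" f euclidean inverse_point] by (simp add: o_def)
  then have "continuous_map X euclidean (\<lambda>p. lambda_map mul e (inverse_point (f p)))"
    by (rule continuous_map_lambda_map)
  then show ?thesis
    by (rule continuous_map_eq) (simp add: nz matrix_inv_lambda_map)
qed

text \<open>The determinant does not vanish on the nonzero vectors, which form a connected set in dimension at
  least two, and it is \<open>1\<close> at the unit of the algebra.\<close>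

lemma det_lambda_map_pos:
  assumes dim: "2 \<le> CARD('n)" and x: "x \<noteq> 0"
  shows "det (lambda_map mul e x) > 0"
proof (rule ccontr)
  assume neg: "\<not> det (lambda_map mul e x) > 0"
  let ?I = "(\<lambda>x. det (lambda_map mul e x)) ` (- {0})"
  have "connected (- {0 :: real^'n})"
    using dim by (intro path_connected_imp_connected path_connected_punctured_universe) simp
  then have "connected ?I"
    by (intro connected_continuous_image continuous_on_compose2 [OF continuous_on_det continuous_on_lambda_map]) auto
  moreover have "1 \<in> ?I"
  proof -
    have "lambda_map mul e (to_coords e one) = mat 1"
      by (simp add: matrix_eq lambda_map_apply)
    then have "1 = det (lambda_map mul e (to_coords e one))"
      by (simp add: det_I)
    moreover have "to_coords e one \<in> - {0}"
      using V.one_neq_0 by simp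
    ultimately show ?thesis
      by (rule image_eqI)
  qed
  moreover have "det (lambda_map mul e x) \<in> ?I"
    using x by blast
  ultimately have "0 \<in> ?I"
    using neg connectedD_interval [of ?I "det (lambda_map mul e x)" 1 0] by auto
  then obtain y where y: "y \<noteq> 0" "det (lambda_map mul e y) = 0"
    by (force simp: image_iff)
  then have "invertible (lambda_map mul e y)"
    using lambda_map_inverse_point invertible_right_inverse by blast
  with y show False
    by (simp add: invertible_det_nz)
qed

lemma rotation_matrix_lambda_map:
  assumes dim: "2 \<le> CARD('n)" and x: "norm x = 1"
  shows "rotation_matrix (lambda_map mul e x)"
proof -
  have "orthogonal_transformation ((\<odot>) x)"
    using x by (simp add: orthogonal_transformation V.linear_mul V.norm_mul)
  moreover have "matrix ((\<odot>) x) = lambda_map mul e x"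
    by (metis (no_types, lifting) ext lambda_map_apply matrix_of_matrix_vector_mul)
  ultimately have o: "orthogonal_matrix (lambda_map mul e x)"
    by (simp add: orthogonal_transformation_matrix)
  have "x \<noteq> 0"
    using x by auto
  then show ?thesis
    using det_lambda_map_pos [OF dim] det_orthogonal_matrix [OF o] o by (force simp: rotation_matrix_def)
qed

text \<open>The straight line from \<open>\<rho> x\<close> to \<open>x\<close> consists of nonzero vectors, whose left multiplications have positive
  determinant; left multiplication is linear in the left factor, so this is a segment of matrices.\<close>

lemma homotopic_radial_normalization:
  assumes dim: "2 \<le> CARD('n)" and \<rho>: "\<rho> > 0"
  shows "homotopic_with_canon (\<lambda>_. True) (sphere 0 1) {A. det A > 0}
    (\<lambda>x. lambda_map mul e (\<rho> *\<^sub>R x)) (lambda_map mul e)"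
proof (rule homotopic_with_linear)
  show "continuous_on (sphere 0 1) (\<lambda>x. lambda_map mul e (\<rho> *\<^sub>R x))"
    by (intro continuous_on_compose2 [OF continuous_on_lambda_map] continuous_intros) auto
  fix x :: "real^'n" assume x: "x \<in> sphere 0 1"
  show "closed_segment (lambda_map mul e (\<rho> *\<^sub>R x)) (lambda_map mul e x) \<subseteq> {A. det A > 0}"
  proof
    fix A assume "A \<in> closed_segment (lambda_map mul e (\<rho> *\<^sub>R x)) (lambda_map mul e x)"
    then obtain t where t: "0 \<le> t" "t \<le> 1"
      and A: "A = (1 - t) *\<^sub>R lambda_map mul e (\<rho> *\<^sub>R x) + t *\<^sub>R lambda_map mul e x"
      by (auto simp: closed_segment_def)
    have "A = lambda_map mul e (((1 - t) * \<rho> + t) *\<^sub>R x)"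
      by (simp add: A lambda_map_add lambda_map_scaleR scaleR_add_left)
    moreover have "(1 - t) * \<rho> + t > 0"
      using t \<rho> by (cases "t = 1") (auto intro: add_pos_nonneg)
    moreover have "x \<noteq> 0"
      using x by auto
    ultimately show "A \<in> {A. det A > 0}"
      using det_lambda_map_pos [OF dim] by simp
  qed
qed (rule continuous_on_lambda_map)

end

section \<open>The coordinate-deletion bundle\<close>

locale deletion_bundle =
  coordinate_algebra mul one N e + projective_charts homog_index basis_index
  for mul :: "'a::real_vector \<Rightarrow> 'a \<Rightarrow> 'a" and one :: 'a and N :: "'a \<Rightarrow> real"
    and e :: "'n::{finite,linorder} \<Rightarrow> 'a"
    and homog_index :: "'m::{finite,linorder} itself" and basis_index :: "'n itself"
begin

abbreviation g :: "'m \<Rightarrow> 'm \<Rightarrow> (real^'m::_) set \<Rightarrow> real^'n::_^'n::_" where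
  "g \<equiv> deletion_transition mul e"

abbreviation M :: "'m \<Rightarrow> (real^'m::_) set \<Rightarrow> real^'n::_^'n::_" where
  "M \<equiv> chart_matrix mul e"

abbreviation X :: "(real^'m::_) set set" where
  "X \<equiv> punctured_space"

lemma chart_matrix_lambda: "M i p = lambda_map mul e (ch i p)"
  by (simp add: chart_matrix_def affine_coord_chart lambda_map_def)

lemma chart_matrix_inverse:
  assumes "p \<in> U i" "ch i p \<noteq> 0"
  shows "M i p ** matrix_inv (M i p) = mat 1" "matrix_inv (M i p) ** M i p = mat 1"
  using lambda_map_inverse [OF assms(2)] by (simp_all add: chart_matrix_lambda)

lemma continuous_map_chart_matrix: "continuous_map (subtopology real_proj_space (U i \<inter> A)) euclidean (M i)"
  unfolding chart_matrix_lambda [abs_def]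
  using continuous_map_from_subtopology [OF continuous_map_chart, of i A]
  by (intro continuous_map_lambda_map) (simp add: subtopology_subtopology)

lemma continuous_map_chart_matrix_inv:
  assumes "\<And>p. p \<in> U i \<inter> A \<Longrightarrow> ch i p \<noteq> 0"
  shows "continuous_map (subtopology real_proj_space (U i \<inter> A)) euclidean (\<lambda>p. matrix_inv (M i p))"
  unfolding chart_matrix_lambda [abs_def]
  using continuous_map_from_subtopology [OF continuous_map_chart, of i A] assms
  by (intro continuous_map_matrix_inv_lambda_map) (simp_all add: subtopology_subtopology)

sublocale bundle_gluing real_proj_space U g
proof
  fix i j k and p :: "(real^'m::_) set"
  show "U i \<subseteq> topspace real_proj_space"
    by (rule std_open_subset)
  show "g i i p = mat 1"
    by (simp add: deletion_transition_def)
  assume "p \<in> U i" "p \<in> U j" "p \<in> U k"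
  then have *: "matrix_inv (M j p) ** M j p = mat 1" if "i \<noteq> j" using that chart_matrix_inverse chart_neq_0 by metis
  have **: "M i p ** matrix_inv (M i p) = mat 1" if "i \<noteq> j"
    using that chart_matrix_inverse chart_neq_0 \<open>p \<in> U i\<close> \<open>p \<in> U j\<close> by metis
  have "M i p ** matrix_inv (M j p) ** (M j p ** matrix_inv (M k p)) = M i p ** matrix_inv (M k p)" if "i \<noteq> j"
    using * [OF that] by (metis matrix_mul_assoc matrix_mul_lid)
  with ** show "g i j p ** g j k p = g i k p"
    by (auto simp: deletion_transition_def)
qed

text \<open>Away from the coordinate points, where all chart matrices are invertible, the formula for distinct
  indices holds on the diagonal as well.\<close>

lemma transition_eq:
  assumes "p \<in> U i" "p \<in> U j" "p \<in> X"
  shows "g i j p = M i p ** matrix_inv (M j p)"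
  using assms chart_matrix_inverse punctured_iff by (auto simp: deletion_transition_def)

text \<open>Over a chart, \<open>\<tau>\<close> is multiplication by the inverse of the chart matrix, and the cocycle form of the
  transition functions makes the value independent of the chart.\<close>

lemma tau_point:
  assumes p: "p \<in> U j \<inter> X"
  shows "tau mul e (glue_point U g (j, p, w)) = (p, matrix_inv (M j p) *v w)"
proof -
  have eq: "matrix_inv (M i p) *v glue_coord i (glue_point U g (j, p, w)) = matrix_inv (M j p) *v w"
    if "p \<in> U i" for i
  proof -
    have "glue_coord i (glue_point U g (j, p, w)) = (M i p ** matrix_inv (M j p)) *v w"
      using p that by (simp add: glue_coord_point transition_eq)
    moreover have "matrix_inv (M i p) ** M i p = mat 1"
      using p that chart_matrix_inverse punctured_iff by auto
    ultimately show ?thesis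
      by (simp add: matrix_vector_mul_assoc matrix_mul_assoc)
  qed
  have "(THE v. \<forall>i. p \<in> U i \<longrightarrow> v = matrix_inv (M i p) *v glue_coord i (glue_point U g (j, p, w)))
      = matrix_inv (M j p) *v w"
    using p eq by (intro the_equality) auto
  then show ?thesis
    using p by (simp add: tau_def glue_proj_point)
qed

lemma is_trivialization_tau: "is_trivialization real_proj_space U g X (tau mul e)"
proof (rule is_trivializationI [where h = "\<lambda>i p. matrix_inv (M i p)" and k = M])
  show "X \<subseteq> (\<Union>i. U i)"
    using std_open_cover by (auto simp: punctured_space_def)
  fix i
  have nz: "ch i p \<noteq> 0" if "p \<in> U i \<inter> X" for p
    using that punctured_iff by auto
  show "matrix_inv (M i p) ** M i p = mat 1" if "p \<in> U i \<inter> X" for p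
    using that nz chart_matrix_inverse by auto
  show "continuous_map (subtopology real_proj_space (U i \<inter> X)) euclidean (\<lambda>p. matrix_inv (M i p))"
    using nz by (rule continuous_map_chart_matrix_inv)
qed (use openin_punctured_space openin_std_open tau_point continuous_map_chart_matrix in auto)

lemma continuous_map_transition: "continuous_map (subtopology real_proj_space (U i \<inter> U j)) euclidean (g i j)"
proof (cases "i = j")
  case True
  then show ?thesis
    by (simp add: deletion_transition_def [abs_def])
next
  case False
  have "continuous_map (subtopology real_proj_space (U j \<inter> U i)) euclidean (\<lambda>p. matrix_inv (M j p))"
    using chart_neq_0 False by (intro continuous_map_chart_matrix_inv) auto
  then show ?thesis
    using False unfolding deletion_transition_def [abs_def]
    by (auto simp: Int_commute intro!: continuous_map_matrix_matrix_mult continuous_map_chart_matrix)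
qed

lemma is_trivialization_local_frame: "is_trivialization real_proj_space U g (U i) (local_frame i)"
proof (rule is_trivializationI [where h = "\<lambda>j. g i j" and k = "\<lambda>j. g j i"])
  fix j
  show "continuous_map (subtopology real_proj_space (U j \<inter> U i)) euclidean (g i j)"
    using continuous_map_transition by (simp add: Int_commute)
qed (use openin_std_open continuous_map_transition in
    \<open>auto simp: local_frame_def glue_proj_point glue_coord_point transition_cocycle transition_refl\<close>)

text \<open>With \<open>w = M\<^sub>j\<inverse> w\<^sub>j\<close> and \<open>w\<^sub>i = M\<^sub>i M\<^sub>j\<inverse> w\<^sub>j\<close> the comparison of the two frames is \<open>w\<^sub>i = M\<^sub>i w\<close>, whatever the
  chart \<open>j\<close> in which the vector is given.\<close>

lemma glue_coord_tau:
  assumes p: "p \<in> U i \<inter> X" and c: "c \<in> topspace (restricted_bundle real_proj_space U g {p})"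
  shows "glue_coord i c = M i p *v snd (tau mul e c)"
proof -
  obtain j w where "c = glue_point U g (j, p, w)" "p \<in> U j"
    using c by (auto simp: topspace_restricted_bundle)
  then show ?thesis
    using p by (simp add: tau_point glue_coord_point transition_eq matrix_vector_mul_assoc)
qed

lemma clutching_map_tau:
  assumes p: "p \<in> U i \<inter> X"
  shows "clutching_map (topspace (restricted_bundle real_proj_space U g X)) (local_frame i) (tau mul e) p = M i p"
proof -
  let ?S = "topspace (restricted_bundle real_proj_space U g X)"
  have inj: "inj_on (tau mul e) ?S"
    using is_trivialization_tau homeomorphic_imp_injective_map unfolding is_trivialization_def by blast
  have nz: "ch i p \<noteq> 0"
    using p punctured_iff by auto
  have "inv_into ?S (tau mul e) (p, w) = glue_point U g (i, p, M i p *v w)" for w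
  proof (rule inv_into_f_eq [OF inj])
    show "glue_point U g (i, p, M i p *v w) \<in> ?S"
      using p unfolding topspace_restricted_bundle by blast
    show "tau mul e (glue_point U g (i, p, M i p *v w)) = (p, w)"
      using p nz chart_matrix_inverse by (simp add: tau_point matrix_vector_mul_assoc)
  qed
  then have "snd (local_frame i (inv_into ?S (tau mul e) (p, w))) = M i p *v w" for w
    using p by (simp add: local_frame_def glue_coord_point transition_refl)
  then show ?thesis
    by (simp add: clutching_map_def)
qed

text \<open>The affine coordinate is injective on the whole chart, so its image determines the ball.\<close>

lemma coordinate_ball_eq:
  assumes B: "B \<subseteq> U i" "bij_betw (affine_coord e i) B {u. N u \<le> \<rho>\<^sup>2}" and \<rho>: "\<rho> > 0"
  shows "B = {p \<in> U i. norm (ch i p) \<le> \<rho>}"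
proof -
  have N: "N (affine_coord e i p) \<le> \<rho>\<^sup>2 \<longleftrightarrow> norm (ch i p) \<le> \<rho>" for p
    using \<rho> by (simp add: affine_coord_chart norm_coords power2_le_iff_abs_le)
  have image: "affine_coord e i ` B = {u. N u \<le> \<rho>\<^sup>2}"
    using B(2) by (simp add: bij_betw_def)
  show ?thesis
  proof (intro equalityI subsetI)
    fix p assume "p \<in> B"
    with image B(1) N show "p \<in> {p \<in> U i. norm (ch i p) \<le> \<rho>}"
      by blast
  next
    fix p assume p: "p \<in> {p \<in> U i. norm (ch i p) \<le> \<rho>}"
    then have "affine_coord e i p \<in> affine_coord e i ` B"
      unfolding image using N by simp
    then obtain p' where p': "p' \<in> B" "affine_coord e i p = affine_coord e i p'"
      by blast
    then have "ch i p = ch i p'"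
      by (metis affine_coord_chart to_from_coords)
    then have "p = p'"
      using p p' B(1) inj_on_chart [of i] by (auto dest: inj_onD)
    with p' show "p \<in> B"
      by simp
  qed
qed

lemma homeomorphic_map_normalized_chart:
  assumes F: "F = {p \<in> U i. norm (ch i p) = \<rho>}" and \<rho>: "\<rho> > 0"
  shows "homeomorphic_map (subtopology real_proj_space F) (top_of_set (sphere 0 1)) (\<lambda>p. (1 / \<rho>) *\<^sub>R ch i p)"
proof -
  have "homeomorphic_map euclidean euclidean ((*\<^sub>R) (1 / \<rho>) :: real^'n::_ \<Rightarrow> _)"
  proof (rule homeomorphic_maps_imp_map)
    show "homeomorphic_maps euclidean euclidean ((*\<^sub>R) (1 / \<rho>) :: real^'n::_ \<Rightarrow> _) ((*\<^sub>R) \<rho>)"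
      using \<rho> by (auto simp: homeomorphic_maps_def intro!: continuous_intros)
  qed
  from homeomorphic_map_compose [OF homeomorphic_map_chart this]
  have "homeomorphic_map (subtopology real_proj_space (U i)) euclidean (\<lambda>p. (1 / \<rho>) *\<^sub>R ch i p)"
    by (simp add: o_def)
  then have "homeomorphic_map (subtopology (subtopology real_proj_space (U i)) F) (top_of_set (sphere 0 1))
      (\<lambda>p. (1 / \<rho>) *\<^sub>R ch i p)"
    using \<rho> std_open_subset by (intro homeomorphic_map_subtopologies_alt) (auto simp: F field_simps)
  moreover have "U i \<inter> F = F"
    by (auto simp: F)
  ultimately show ?thesis
    by (simp add: subtopology_subtopology)
qed

text \<open>On a sphere of radius \<open>\<rho>\<close> the clutching map is left multiplication by \<open>\<rho> u\<close> for the normalized point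
  \<open>u\<close>, so the radial homotopy on the unit sphere is pulled back along the normalization.\<close>

lemma homotopic_clutching_map:
  assumes F: "F = {p \<in> U i. norm (ch i p) = \<rho>}" and \<rho>: "\<rho> > 0" and dim: "2 \<le> CARD('n)"
  shows "homotopic_with (\<lambda>_. True) (subtopology real_proj_space F) (top_of_set {A. det A > 0})
    (clutching_map (topspace (restricted_bundle real_proj_space U g X)) (local_frame i) (tau mul e))
    (\<lambda>p. lambda_map mul e ((1 / \<rho>) *\<^sub>R ch i p))"
proof -
  let ?n = "\<lambda>p. (1 / \<rho>) *\<^sub>R ch i p"
  have "homotopic_with (\<lambda>_. True) (subtopology real_proj_space F) (top_of_set {A. det A > 0})
      ((\<lambda>x. lambda_map mul e (\<rho> *\<^sub>R x)) \<circ> ?n) (lambda_map mul e \<circ> ?n)"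
    by (rule homotopic_with_compose_continuous_map_right [OF homotopic_radial_normalization [OF dim \<rho>]
        homeomorphic_imp_continuous_map [OF homeomorphic_map_normalized_chart [OF F \<rho>]]]) simp
  then show ?thesis
  proof (rule homotopic_with_eq)
    fix p assume "p \<in> topspace (subtopology real_proj_space F)"
    then have "p \<in> U i" "ch i p \<noteq> 0"
      using \<rho> by (auto simp: F)
    then have "p \<in> U i \<inter> X"
      using punctured_iff by auto
    then show "clutching_map (topspace (restricted_bundle real_proj_space U g X)) (local_frame i) (tau mul e) p
        = ((\<lambda>x. lambda_map mul e (\<rho> *\<^sub>R x)) \<circ> ?n) p"
      using \<rho> by (simp add: clutching_map_tau chart_matrix_lambda)
  qed simp_all
qed

end

theorem theorem4p3:
  fixes mul :: "'a::real_vector \<Rightarrow> 'a \<Rightarrow> 'a" and one :: 'a and N :: "'a \<Rightarrow> real"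
    and e :: "'n::{finite,linorder} \<Rightarrow> 'a"
    and B :: "'m::{finite,linorder} \<Rightarrow> (real^'m::_) set set"
  defines "P \<equiv> (real_proj_space :: (real^'m::_) set topology)"
    and "U \<equiv> (std_open :: 'm \<Rightarrow> (real^'m::_) set set)"
    and "X \<equiv> (punctured_space :: (real^'m::_) set set)"
    and "g \<equiv> (deletion_transition mul e :: 'm \<Rightarrow> 'm \<Rightarrow> (real^'m::_) set \<Rightarrow> real^'n::_^'n::_)"
    and "q \<equiv> (affine_coord e :: 'm \<Rightarrow> (real^'m::_) set \<Rightarrow> 'a)"
    and "\<tau> \<equiv> (tau mul e :: ('m \<times> (real^'m::_) set \<times> (real^'n::_)) set \<Rightarrow> (real^'m::_) set \<times> (real^'n::_))"
  assumes D: "composition_division_algebra mul one N"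
    and e: "orthonormal_basis N e"
    and d: "CARD('n) \<in> {2, 4, 8}" "CARD('m) = CARD('n) + 1"
    and ball: "\<And>i. B i \<subseteq> U i \<and> (\<exists>\<rho>>0. bij_betw (q i) (B i) {u. N u \<le> \<rho>\<^sup>2})"
    and disj: "\<And>i j. i \<noteq> j \<Longrightarrow> B i \<inter> B j = {}"
  shows "(\<forall>i. is_trivialization P U g (U i) (local_frame i)) \<and>
    is_trivialization P U g X \<tau> \<and>
    (\<forall>i. \<forall>p \<in> P frontier_of (B i). p \<in> U i \<inter> X \<and>
       (\<forall>c \<in> topspace (restricted_bundle P U g {p}).
          glue_coord i c = left_mult_matrix mul e (q i p) *v snd (\<tau> c)) \<and>
       clutching_map (topspace (restricted_bundle P U g X)) (local_frame i) \<tau> p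
         = left_mult_matrix mul e (q i p)) \<and>
    continuous_on (sphere 0 1) (lambda_map mul e) \<and>
    (\<forall>x \<in> sphere 0 1. rotation_matrix (lambda_map mul e x)) \<and>
    (\<forall>i. homeomorphic_map (subtopology P (P frontier_of (B i))) (top_of_set (sphere 0 1))
            (\<lambda>p. to_coords e ((1 / sqrt (N (q i p))) *\<^sub>R q i p)) \<and>
       homotopic_with (\<lambda>_. True)
         (subtopology P (P frontier_of (B i))) (top_of_set {A. det A > 0})
         (clutching_map (topspace (restricted_bundle P U g X)) (local_frame i) \<tau>)
         (\<lambda>p. lambda_map mul e (to_coords e ((1 / sqrt (N (q i p))) *\<^sub>R q i p)))) \<and>
    (\<forall>\<phi> :: 'a \<Rightarrow> complex. composition_iso mul N (*) \<phi> \<longrightarrow>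
       real_clutching_of_tautological (*) 1 (\<phi> \<circ> from_coords e) (lambda_map mul e)) \<and>
    (\<forall>\<phi> :: 'a \<Rightarrow> quat. composition_iso mul N quat_mult \<phi> \<longrightarrow>
       real_clutching_of_tautological quat_mult (1, 0) (\<phi> \<circ> from_coords e) (lambda_map mul e)) \<and>
    (\<forall>\<phi> :: 'a \<Rightarrow> oct. composition_iso mul N oct_mult \<phi> \<longrightarrow>
       octonionic_hopf_clutching (\<phi> \<circ> from_coords e) (lambda_map mul e))"
proof -
  interpret D: deletion_bundle mul one N e "TYPE('m)" "TYPE('n)"
    using D e d(2) by (simp add: deletion_bundle_def coordinate_algebra_def projective_charts_def)
  have dim: "2 \<le> CARD('n)"
    using d(1) by auto
  obtain \<rho> where \<rho>: "\<And>i. \<rho> i > 0" and bij: "\<And>i. bij_betw (q i) (B i) {u. N u \<le> (\<rho> i)\<^sup>2}"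
    using ball by metis
  have F: "P frontier_of (B i) = {p \<in> D.U i. norm (D.ch i p) = \<rho> i}" for i
    unfolding P_def
    using D.chart_ball_frontier [OF D.coordinate_ball_eq \<rho>] ball bij \<rho>
    by (simp add: U_def q_def)
  have M: "left_mult_matrix mul e (q i p) = D.M i p" for i p
    by (simp add: q_def chart_matrix_def)
  have normalized: "to_coords e ((1 / sqrt (N (q i p))) *\<^sub>R q i p) = (1 / \<rho> i) *\<^sub>R D.ch i p"
    if "p \<in> P frontier_of (B i)" for i p
    using that \<rho> [of i]
    by (simp add: F q_def affine_coord_chart D.norm_coords linear_scale [OF D.linear_to_coords])
  have "\<forall>i. is_trivialization P U g (U i) (local_frame i)"
    using D.is_trivialization_local_frame by (simp add: P_def U_def g_def)
  moreover have "is_trivialization P U g X \<tau>"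
    using D.is_trivialization_tau by (simp add: P_def U_def g_def X_def \<tau>_def)
  moreover have "p \<in> U i \<inter> X \<and>
       (\<forall>c \<in> topspace (restricted_bundle P U g {p}).
          glue_coord i c = left_mult_matrix mul e (q i p) *v snd (\<tau> c)) \<and>
       clutching_map (topspace (restricted_bundle P U g X)) (local_frame i) \<tau> p
         = left_mult_matrix mul e (q i p)" if "p \<in> P frontier_of (B i)" for i p
  proof -
    have "p \<in> D.U i" "D.ch i p \<noteq> 0"
      using that \<rho> [of i] by (auto simp: F)
    then have "p \<in> D.U i \<inter> D.X"
      using D.punctured_iff by auto
    then show ?thesis
      unfolding M using D.glue_coord_tau [of p i] D.clutching_map_tau [of p i]
      by (simp add: P_def U_def g_def X_def \<tau>_def)
  qed
  moreover have "continuous_on (sphere 0 1) (lambda_map mul e)"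
    by (rule D.continuous_on_lambda_map)
  moreover have "\<forall>x \<in> sphere 0 1. rotation_matrix (lambda_map mul e x)"
    using D.rotation_matrix_lambda_map [OF dim] by simp
  moreover have "homeomorphic_map (subtopology P (P frontier_of (B i))) (top_of_set (sphere 0 1))
        (\<lambda>p. to_coords e ((1 / sqrt (N (q i p))) *\<^sub>R q i p))" for i
    using D.homeomorphic_map_normalized_chart [OF F \<rho>, folded P_def, of i]
    by (rule homeomorphic_map_eq) (simp add: normalized)
  moreover have "homotopic_with (\<lambda>_. True)
         (subtopology P (P frontier_of (B i))) (top_of_set {A. det A > 0})
         (clutching_map (topspace (restricted_bundle P U g X)) (local_frame i) \<tau>)
         (\<lambda>p. lambda_map mul e (to_coords e ((1 / sqrt (N (q i p))) *\<^sub>R q i p)))" for i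
    using D.homotopic_clutching_map [OF F \<rho> dim, folded P_def U_def g_def X_def \<tau>_def]
    by (rule homotopic_with_eq) (simp_all add: normalized)
  moreover have "real_clutching_of_tautological (*) 1 (\<phi> \<circ> from_coords e) (lambda_map mul e)"
    if "composition_iso mul N (*) \<phi>" for \<phi> :: "'a \<Rightarrow> complex"
    using that by (rule D.tautological_clutching_lambda) (simp_all add: mult.assoc)
  moreover have "real_clutching_of_tautological quat_mult (1, 0) (\<phi> \<circ> from_coords e) (lambda_map mul e)"
    if "composition_iso mul N quat_mult \<phi>" for \<phi> :: "'a \<Rightarrow> quat"
    using that by (rule D.tautological_clutching_lambda) (simp_all add: quat_mult_one quat_mult_assoc)
  moreover have "octonionic_hopf_clutching (\<phi> \<circ> from_coords e) (lambda_map mul e)"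
    if "composition_iso mul N oct_mult \<phi>" for \<phi> :: "'a \<Rightarrow> oct"
    using that by (rule D.octonionic_clutching_lambda)
  ultimately show ?thesis
    by blast
qed

end
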